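(* Let $(A,\langle\,,\,\rangle,\mathfrak m_1=d,\mathfrak m_2)$ be a finite dimensional cyclic DGA over $\mathbb{R}$ whose pairing has degree $-n$. Define $\mathfrak m_2^+\in B_3^{\mathrm{cyc}*}A$ by $\mathfrak m_2^+(x_0,x_1,x_2)=(-1)^{n-2}\langle\mathfrak m_2(x_0,x_1),x_2\rangle$. Then $\mathfrak m_2^+$ (that is, the collection with $\mathfrak m_{1,0}=\mathfrak m_2^+$ and $\mathfrak m_{\ell,g}=0$ for $(\ell,g)\ne(1,0)$) is a Maurer-Cartan element in the filtered $\mathrm{dIBL}$-algebra (of bidegree $(n-3,2)$) given by the dual cyclic bar complex $\mathbf C=(B^{\mathrm{cyc}*}A)[2-n]$ (completed with respect to its canonical filtration) with operations $\mathfrak p_{1,1,0},\mathfrak p_{2,1,0},\mathfrak p_{1,2,0}$.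
   Context: **Cyclic cochain complexes and cyclic DGAs.** $n$ is a positive integer, $A=\bigoplus_kA^k$ a $\mathbb{Z}$-graded real vector space with differential $d$ of degree $+1$, $\langle\,,\,\rangle$ a nondegenerate bilinear form, nonzero only on $A^k\otimes A^{n-k}$ (degree $-n$). $|x|:=\deg x-1$ is the degree in $A[1]$ (where $X[m]^j:=X^{j+m}$). $(A,\langle\,,\,\rangle,d)$ is a cyclic cochain complex if $\langle dx,y\rangle+(-1)^{|x|}\langle x,dy\rangle=0$ and $\langle x,y\rangle+(-1)^{|x||y|}\langle y,x\rangle=0$. A cyclic $A_\infty$-structure on it is a series of degree $1$ maps $\mathfrak m_k:A[1]^{\otimes k}\to A[1]$, $k\ge2$, such that with $\mathfrak m_1=d$, for all $r\ge1$, $$\sum_{k+\ell=r+1,\,k,\ell\ge1}\ \sum_{c=1}^{r+1-\ell}(-1)^{|x_1|+\cdots+|x_{c-1}|}\mathfrak m_k(x_1,\dots,\mathfrak m_\ell(x_c,\dots,x_{c+\ell-1}),\dots,x_r)=0,$$ and $\langle\mathfrak m_k(x_1,\dots,x_k),x_0\rangle=(-1)^{|x_0|(|x_1|+\cdots+|x_k|)}\langle\mathfrak m_k(x_0,\dots,x_{k-1}),x_k\rangle$. A cyclic DGA is a cyclic $A_\infty$-algebra with $\mathfrak m_k=0$ for $k\ge3$. **Dual cyclic bar complex.** $B^{\mathrm{cyc}}_kA$ is the quotient of $A[1]^{\otimes k}$ by cyclic permutations with Koszul signs, $B^{\mathrm{cyc}*}_kA=\mathrm{Hom}(B^{\mathrm{cyc}}_kA,\mathbb{R})$,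 $B^{\mathrm{cyc}*}A=\bigoplus_{k\ge1}B^{\mathrm{cyc}*}_kA$. $\varphi\in B_k^{\mathrm{cyc}*}A$ has degree $|\varphi|=D$ if $\varphi(x_1,\dots,x_k)=0$ whenever $\sum|x_i|\ne D$. Let $\{e_i\}$ be a homogeneous basis of $A$, $\eta_i=|e_i|$, $\{e^i\}$ the dual basis ($\langle e_i,e^j\rangle=\delta_i^j$), $g^{ij}=\langle e^i,e^j\rangle$. For $\varphi^1\in B_{k_1+1}^{\mathrm{cyc}*}A$, $\varphi^2\in B_{k_2+1}^{\mathrm{cyc}*}A$, $k_1+k_2\ge1$ ($\mu=0$ if $k_1=k_2=0$), indices modulo $k_1+k_2$, $$\mu(\varphi^1,\varphi^2)(x_1,\dots,x_{k_1+k_2})=\sum_{a,b}\sum_{c=1}^{k_1+k_2}(-1)^{\eta_a+\eta}g^{ab}\varphi^1(e_a,x_c,\dots,x_{c+k_1-1})\varphi^2(e_b,x_{c+k_1},\dots,x_{c-1}),$$ $\eta=\sum_{r=1}^{c-1}\sum_{s=c}^{k_1+k_2}|x_r||x_s|+\eta_b\sum_{t=c}^{c+k_1-1}|x_t|$. For $\varphi\in B^{\mathrm{cyc}*}_kA$, $k\ge4$ ($\delta=0$ for $k\le3$), $\delta(\varphi)\in\bigoplus_{k_1+k_2=k-2,\,k_i\ge1}B^{\mathrm{cyc}*}_{k_1}A\otimes B^{\mathrm{cyc}*}_{k_2}A$ is $$\delta\varphi(x_1\cdots x_{k_1}\otimes y_1\cdots y_{k_2})=\sum_{a,b}\sum_{c=1}^{k_1}\sum_{c'=1}^{k_2}(-1)^{\eta_a+\eta}g^{ab}\varphi(e_a,x_c,\dots,x_{c-1},e_b,y_{c'},\dots,y_{c'-1}),$$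 (indices cyclic in the $x$'s and $y$'s), $\eta=\sum_{r=1}^{c-1}\sum_{s=c}^{k_1}|x_r||x_s|+\sum_{r=1}^{c'-1}\sum_{s=c'}^{k_2}|y_r||y_s|+\eta_b\sum_{t=1}^{k_1}|x_t|$. On $\mathbf C=(B^{\mathrm{cyc}*}A)[2-n]$: $\mathfrak p_{1,1,0}(\varphi)(x_1,\dots,x_k)=\sum_{j}(-1)^{|x_1|+\cdots+|x_{j-1}|}\varphi(x_1,\dots,dx_j,\dots,x_k)$; $\mathfrak p_{2,1,0}(\varphi,\psi)=(-1)^{(n-3)|\varphi|}\mu(\varphi,\psi)$; $\mathfrak p_{1,2,0}(\varphi)(x,y)=\tfrac12(-1)^{(n-3)|x|}\delta(\varphi)(x,y)$ for words $x,y$. These induce maps $E_k\mathbf C\to E_\ell\mathbf C$, where $E_k\mathbf C$ is the quotient of $\mathbf C[1]^{\otimes k}$ by signed permutations. **Filtered $\mathrm{IBL}_\infty$-algebras and Maurer-Cartan elements** (over $\mathbb{R}$ with trivial valuation). For a filtered graded space $C$ with valuation $\|\cdot\|$, i.e. filtration $\mathcal F^\lambda C=\{c:\|c\|\ge\lambda\}$, $\widehat E_kC$ is the completion of the quotient $E_kC$ of $C[1]^{\otimes k}$ by signed permutations, with respect to the filtration $\mathcal F^\lambda$ spanned by products $c_1\cdots c_k$, $c_i\in\mathcal F^{\lambda_i}C[1]$, $\sum\lambda_i=\lambda$; $\widehat E_0C=\mathbb{R}$; $\widehat EC$ is the completion of $\bigoplus_{k\ge0}\widehat E_kC$ with respect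 to this filtration and the filtration by $\bigoplus_{k\ge\lambda}\widehat E_kC$, i.e. infinite sums $\sum c_i$, $c_i\in\mathcal F^{\lambda_i}E_{k_i}C$, $\max\{k_i,\lambda_i\}\to\infty$. The filtration degree $\|f\|$ of a linear map is the largest $K$ with $f(\mathcal F^\lambda)\subset\mathcal F^{\lambda+K}$ for all $\lambda$. A map $\phi:\widehat E_kC\to\widehat E_\ell C$ extends to $\hat\phi:\widehat EC\to\widehat EC$ by $\hat\phi(c_1\cdots c_m)=\sum_{\rho\in S_m}\frac{\varepsilon(\rho)}{k!(m-k)!}\phi(c_{\rho(1)}\cdots c_{\rho(k)})c_{\rho(k+1)}\cdots c_{\rho(m)}$ for $m\ge k$, $0$ for $m<k$, with $c_{\rho(1)}\cdots c_{\rho(m)}=\varepsilon(\rho)c_1\cdots c_m$. With $\chi_{k,\ell,g}=2-2g-k-\ell$, a (strict) filtered $\mathrm{IBL}_\infty$-structure of bidegree $(d_0,\gamma)$, $\gamma\ge0$, consists of maps $\mathfrak p_{k,\ell,g}:\widehat E_kC\to\widehat E_\ell C$, $k,\ell\ge1,g\ge0$, of degree $-2d_0(k+g-1)-1$ with $\|\mathfrak p_{k,\ell,g}\|\ge\gamma\chi_{k,\ell,g}$ and $\hat{\mathfrak p}\circ\hat{\mathfrak p}=0$ for $\hat{\mathfrak p}=\sum\hat{\mathfrak p}_{k,\ell,g}\hbar^{k+g-1}$ on $\widehat EC\{\hbar\}$; it is a $\mathrm{dIBL}$-structure if only $\mathfrak p_{1,1,0},\mathfrak p_{2,1,0},\mathfrak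 p_{1,2,0}$ are nonzero. On $\mathbf C$ one uses $\mathcal F^\lambda B^{\mathrm{cyc}*}A=\bigoplus_{k\ge\lambda}B_k^{\mathrm{cyc}*}A$; its completion is $\prod_kB_k^{\mathrm{cyc}*}A$, and the operations $\mathfrak p_{1,1,0}$ (induced by $d$), $\mathfrak p_{2,1,0}$ (given by $(-1)^{(n-3)|\varphi|}\mu(\varphi,\psi)$) and $\mathfrak p_{1,2,0}$ (given by $\tfrac12(-1)^{(n-3)|x|}\delta(\varphi)(x,y)$) on $\mathbf C$ form a strict filtered $\mathrm{dIBL}$-structure of bidegree $(n-3,2)$. A Maurer-Cartan element is a collection $\mathfrak m_{\ell,g}\in\widehat E_\ell C$, $\ell\ge1,g\ge0$, of degree $-2d_0(g-1)$, with $\|\mathfrak m_{\ell,g}\|\ge\gamma\chi_{0,\ell,g}$, strictly for $(\ell,g)=(1,0),(2,0)$, such that $\mathfrak m=\sum\mathfrak m_{\ell,g}\hbar^{g-1}$ satisfies $\hat{\mathfrak p}(e^{\mathfrak m})=0$ (the exponential being taken in the symmetric algebra with powers of $\hbar,\hbar^{-1}$; the expression converges for the filtration). *)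

theory Defs
  imports
    "HOL-Analysis.Analysis"
    "HOL-Library.Function_Algebras"
    "HOL-Analysis.Finite_Function_Topology"
    "HOL-Combinatorics.Permutations"
begin

instantiation "fun" :: (type, real_vector) real_vector
begin

definition scaleR_fun :: "real \<Rightarrow> ('a \<Rightarrow> 'b) \<Rightarrow> 'a \<Rightarrow> 'b"
  where "scaleR_fun r f = (\<lambda>x. r *\<^sub>R f x)"

instance
  by standard (auto simp: scaleR_fun_def fun_eq_iff scaleR_add_right scaleR_add_left)

end

section \<open>Graded vector spaces\<close>

abbreviation ksign :: "int \<Rightarrow> real"
  where "ksign k \<equiv> (-1) powi k"

definition shift :: "int \<Rightarrow> (int \<Rightarrow> 'v set) \<Rightarrow> int \<Rightarrow> 'v set"
  where "shift m X = (\<lambda>j. X (j + m))"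

definition homog :: "(int \<Rightarrow> 'v set) \<Rightarrow> 'v set"
  where "homog X = (\<Union>j. X j)"

text \<open>The degree of a nonzero homogeneous vector. The zero vector is homogeneous of every degree, so
  its \<open>hdeg\<close> is unspecified; it occurs below only in signs in front of expressions that vanish
  (in the symmetric algebra: that are zero modulo \<open>sym_rels\<close>).\<close>

definition hdeg :: "(int \<Rightarrow> 'v set) \<Rightarrow> 'v \<Rightarrow> int"
  where "hdeg X v = (THE j. v \<in> X j)"

definition is_decomposition :: "(int \<Rightarrow> 'v::real_vector set) \<Rightarrow> 'v \<Rightarrow> (int \<Rightarrow> 'v) \<Rightarrow> bool"
  where "is_decomposition X v f \<longleftrightarrow>
    (\<forall>j. f j \<in> X j) \<and> finite {j. f j \<noteq> 0} \<and> v = (\<Sum>j | f j \<noteq> 0. f j)"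

definition grading :: "(int \<Rightarrow> 'v::real_vector set) \<Rightarrow> bool"
  where "grading X \<longleftrightarrow> (\<forall>j. subspace (X j)) \<and> (\<forall>v. \<exists>!f. is_decomposition X v f)"

definition hcomp :: "(int \<Rightarrow> 'v::real_vector set) \<Rightarrow> 'v \<Rightarrow> int \<Rightarrow> 'v"
  where "hcomp X v = (THE f. is_decomposition X v f)"

definition multilinear :: "nat \<Rightarrow> ('v::real_vector list \<Rightarrow> 'w::real_vector) \<Rightarrow> bool"
  where "multilinear k f \<longleftrightarrow>
    (\<forall>us vs. length us + length vs + 1 = k \<longrightarrow> linear (\<lambda>x. f (us @ x # vs)))"

text \<open>Formulas with Koszul signs are written for homogeneous arguments; \<open>mlext X F\<close> is the
  multilinear extension of such a formula \<open>F\<close> to arbitrary arguments. Only homogeneous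
  components that are nonzero are fed to \<open>F\<close>.\<close>

definition mlext :: "(int \<Rightarrow> 'v::real_vector set) \<Rightarrow> ('v list \<Rightarrow> real) \<Rightarrow> 'v list \<Rightarrow> real"
  where "mlext X F xs =
    (\<Sum>ds \<in> {ds. list_all2 (\<lambda>x j. hcomp X x j \<noteq> 0) xs ds}. F (map2 (hcomp X) xs ds))"

section \<open>Cyclic cochain complexes and cyclic DGAs\<close>

text \<open>\<open>sdeg G x\<close> is $|x| = \deg x - 1$, the degree of $x$ in $A[1]$, and \<open>wdeg\<close> the total degree of a
  word in $A[1]$.\<close>

definition sdeg :: "(int \<Rightarrow> 'a set) \<Rightarrow> 'a \<Rightarrow> int"
  where "sdeg G x = hdeg G x - 1"

definition wdeg :: "(int \<Rightarrow> 'a set) \<Rightarrow> 'a list \<Rightarrow> int"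
  where "wdeg G xs = (\<Sum>x\<leftarrow>xs. sdeg G x)"

definition cyclic_cochain_complex ::
    "nat \<Rightarrow> (int \<Rightarrow> 'a::real_vector set) \<Rightarrow> ('a \<Rightarrow> 'a \<Rightarrow> real) \<Rightarrow> ('a \<Rightarrow> 'a) \<Rightarrow> bool"
  where "cyclic_cochain_complex n G pr d \<longleftrightarrow>
    n \<ge> 1 \<and> grading G \<and>
    linear d \<and> (\<forall>k. d ` G k \<subseteq> G (k + 1)) \<and> (\<forall>x. d (d x) = 0) \<and>
    bilinear pr \<and>
    (\<forall>x. (\<forall>y. pr x y = 0) \<longrightarrow> x = 0) \<and> (\<forall>y. (\<forall>x. pr x y = 0) \<longrightarrow> y = 0) \<and>
    (\<forall>i j. \<forall>x\<in>G i. \<forall>y\<in>G j. i + j \<noteq> int n \<longrightarrow> pr x y = 0) \<and>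
    (\<forall>x\<in>homog G. \<forall>y\<in>homog G. pr (d x) y + ksign (sdeg G x) * pr x (d y) = 0) \<and>
    (\<forall>x\<in>homog G. \<forall>y\<in>homog G. pr x y + ksign (sdeg G x * sdeg G y) * pr y x = 0)"

text \<open>In the $A_\infty$-relations the entries of \<open>xs\<close> are $x_1,\dots,x_r$ and \<open>i\<close> is $c-1$.
  A degree 1 map $A[1]^{\otimes k} \to A[1]$ sends arguments of degrees \<open>ds\<close> in $A$ to degree
  \<open>sum (ds - 1) + 2\<close> in $A$.\<close>

definition cyclic_A_infinity ::
    "nat \<Rightarrow> (int \<Rightarrow> 'a::real_vector set) \<Rightarrow> ('a \<Rightarrow> 'a \<Rightarrow> real) \<Rightarrow> ('a \<Rightarrow> 'a) \<Rightarrow>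
      (nat \<Rightarrow> 'a list \<Rightarrow> 'a) \<Rightarrow> bool"
  where "cyclic_A_infinity n G pr d m \<longleftrightarrow>
    cyclic_cochain_complex n G pr d \<and>
    (\<forall>x. m 1 [x] = d x) \<and>
    (\<forall>k\<ge>2. multilinear k (m k)) \<and>
    (\<forall>k\<ge>2. \<forall>xs ds. length xs = k \<longrightarrow> list_all2 (\<lambda>x j. x \<in> G j) xs ds \<longrightarrow>
       m k xs \<in> G ((\<Sum>j\<leftarrow>ds. j - 1) + 2)) \<and>
    (\<forall>r\<ge>1. \<forall>xs. length xs = r \<longrightarrow> set xs \<subseteq> homog G \<longrightarrow>
       (\<Sum>l=1..r. \<Sum>i\<le>r - l. ksign (wdeg G (take i xs)) *\<^sub>R
          m (r + 1 - l) (take i xs @ m l (take l (drop i xs)) # drop (i + l) xs)) = 0) \<and>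
    (\<forall>k\<ge>2. \<forall>x0\<in>homog G. \<forall>xs. length xs = k \<longrightarrow> set xs \<subseteq> homog G \<longrightarrow>
       pr (m k xs) x0 = ksign (sdeg G x0 * wdeg G xs) * pr (m k (x0 # butlast xs)) (last xs))"

definition cyclic_DGA ::
    "nat \<Rightarrow> (int \<Rightarrow> 'a::real_vector set) \<Rightarrow> ('a \<Rightarrow> 'a \<Rightarrow> real) \<Rightarrow> ('a \<Rightarrow> 'a) \<Rightarrow>
      (nat \<Rightarrow> 'a list \<Rightarrow> 'a) \<Rightarrow> bool"
  where "cyclic_DGA n G pr d m \<longleftrightarrow>
    cyclic_A_infinity n G pr d m \<and> (\<forall>k\<ge>3. \<forall>xs. length xs = k \<longrightarrow> m k xs = 0)"

definition homogeneous_basis :: "(int \<Rightarrow> 'a::real_vector set) \<Rightarrow> 'a set \<Rightarrow> bool"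
  where "homogeneous_basis G E \<longleftrightarrow> E \<subseteq> homog G \<and> independent E \<and> span E = UNIV"

text \<open>For a basis \<open>E\<close> $= \{e_a\}$, basis vectors serve as their own indices: \<open>dual_vec pr E a\<close> is
  $e^a$ and \<open>ginv pr E a b\<close> is $g^{ab}$.\<close>

definition dual_vec :: "('a \<Rightarrow> 'a \<Rightarrow> real) \<Rightarrow> 'a set \<Rightarrow> 'a \<Rightarrow> 'a"
  where "dual_vec pr E b = (THE v. \<forall>a\<in>E. pr a v = (if a = b then 1 else 0))"

definition ginv :: "('a \<Rightarrow> 'a \<Rightarrow> real) \<Rightarrow> 'a set \<Rightarrow> 'a \<Rightarrow> 'a \<Rightarrow> real"
  where "ginv pr E a b = pr (dual_vec pr E a) (dual_vec pr E b)"

section \<open>Symmetric algebras of filtered graded spaces\<close>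

text \<open>Here \<open>V\<close> is the graded space $C[1]$. Elements of $V^{\otimes k}$ and of its quotient $E_k C$ are
  represented by formal linear combinations of words of length \<open>k\<close> in homogeneous elements of \<open>V\<close>.\<close>

abbreviation tw :: "'c list \<Rightarrow> 'c list \<Rightarrow>\<^sub>0 real"
  where "tw cs \<equiv> Poly_Mapping.single cs 1"

definition tlin :: "('c list \<Rightarrow> 'w::real_vector) \<Rightarrow> ('c list \<Rightarrow>\<^sub>0 real) \<Rightarrow> 'w"
  where "tlin f t = (\<Sum>cs\<in>Poly_Mapping.keys t. Poly_Mapping.lookup t cs *\<^sub>R f cs)"

definition tmul :: "('c list \<Rightarrow>\<^sub>0 real) \<Rightarrow> ('c list \<Rightarrow>\<^sub>0 real) \<Rightarrow> ('c list \<Rightarrow>\<^sub>0 real)"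
  where "tmul s t = tlin (\<lambda>us. tlin (\<lambda>vs. tw (us @ vs)) t) s"

definition words :: "(int \<Rightarrow> 'c set) \<Rightarrow> nat \<Rightarrow> 'c list set"
  where "words V k = {cs. length cs = k \<and> set cs \<subseteq> homog V}"

text \<open>The sign $\varepsilon(\rho)$ with
  $c_{\rho(1)} \cdots c_{\rho(k)} = \varepsilon(\rho)\, c_1 \cdots c_k$.\<close>

definition koszul :: "(int \<Rightarrow> 'c set) \<Rightarrow> (nat \<Rightarrow> nat) \<Rightarrow> 'c list \<Rightarrow> real"
  where "koszul V \<rho> cs =
    (\<Prod>(i, j) \<in> {(i, j). i < j \<and> j < length cs \<and> \<rho> j < \<rho> i}.
       ksign (hdeg V (cs ! \<rho> i) * hdeg V (cs ! \<rho> j)))"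

text \<open>Relations whose span is factored out to obtain $E_k C$: multilinearity (which turns formal
  combinations of words into tensors) and signed permutations.\<close>

definition sym_rels :: "(int \<Rightarrow> 'c::real_vector set) \<Rightarrow> nat \<Rightarrow> ('c list \<Rightarrow>\<^sub>0 real) set"
  where "sym_rels V k =
    {tw (us @ (a *\<^sub>R x + b *\<^sub>R y) # vs) - a *\<^sub>R tw (us @ x # vs) - b *\<^sub>R tw (us @ y # vs)
       | us vs a b x y j. x \<in> V j \<and> y \<in> V j \<and> us @ x # vs \<in> words V k} \<union>
    {tw (permute_list \<rho> cs) - koszul V \<rho> cs *\<^sub>R tw cs
       | \<rho> cs. cs \<in> words V k \<and> \<rho> permutes {..<k}}"

text \<open>The preimage of $\mathcal F^\lambda E_k C$ among formal combinations of words. For \<open>k \<ge> 1\<close> the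
  condition $\lambda \le \sum \lambda_i$ is the same as equality, since the filtration is decreasing;
  for \<open>k = 0\<close> it gives the trivial valuation on $\mathbb R$.\<close>

definition sym_filt ::
    "(int \<Rightarrow> 'c::real_vector set) \<Rightarrow> (real \<Rightarrow> 'c set) \<Rightarrow> nat \<Rightarrow> real \<Rightarrow> ('c list \<Rightarrow>\<^sub>0 real) set"
  where "sym_filt V F k lam = span (sym_rels V k \<union>
    {tw cs | cs ls. cs \<in> words V k \<and> list_all2 (\<lambda>c l. c \<in> F l) cs ls \<and> lam \<le> sum_list ls})"

text \<open>Elements of the completion $\widehat E_k C$ are represented by Cauchy sequences; two sequences
  represent the same element if their difference lies eventually in every $\mathcal F^\lambda$.
  \<open>norm_ge V F k lam x\<close> says that $\|x\| \ge \lambda$ in $\widehat E_k C$.\<close>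

definition Ehat ::
    "(int \<Rightarrow> 'c::real_vector set) \<Rightarrow> (real \<Rightarrow> 'c set) \<Rightarrow> nat \<Rightarrow> (nat \<Rightarrow> 'c list \<Rightarrow>\<^sub>0 real) set"
  where "Ehat V F k = {x. (\<forall>i. x i \<in> span (tw ` words V k)) \<and>
    (\<forall>lam. \<exists>N. \<forall>i\<ge>N. \<forall>j\<ge>N. x i - x j \<in> sym_filt V F k lam)}"

definition norm_ge ::
    "(int \<Rightarrow> 'c::real_vector set) \<Rightarrow> (real \<Rightarrow> 'c set) \<Rightarrow> nat \<Rightarrow> real \<Rightarrow>
      (nat \<Rightarrow> 'c list \<Rightarrow>\<^sub>0 real) \<Rightarrow> bool"
  where "norm_ge V F k lam x \<longleftrightarrow> (\<forall>\<^sub>F i in sequentially. x i \<in> sym_filt V F k lam)"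

definition norm_gt ::
    "(int \<Rightarrow> 'c::real_vector set) \<Rightarrow> (real \<Rightarrow> 'c set) \<Rightarrow> nat \<Rightarrow> real \<Rightarrow>
      (nat \<Rightarrow> 'c list \<Rightarrow>\<^sub>0 real) \<Rightarrow> bool"
  where "norm_gt V F k lam x \<longleftrightarrow> (\<exists>lam'>lam. norm_ge V F k lam' x)"

definition Ehat_degree ::
    "(int \<Rightarrow> 'c::real_vector set) \<Rightarrow> (real \<Rightarrow> 'c set) \<Rightarrow> nat \<Rightarrow> int \<Rightarrow>
      (nat \<Rightarrow> 'c list \<Rightarrow>\<^sub>0 real) \<Rightarrow> bool"
  where "Ehat_degree V F k D x \<longleftrightarrow> (\<forall>lam. \<forall>\<^sub>F i in sequentially. x i \<in> span (sym_filt V F k lam \<union>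
    {tw cs | cs ds. length cs = k \<and> list_all2 (\<lambda>c j. c \<in> V j) cs ds \<and> sum_list ds = D}))"

text \<open>\<open>op_ext V k p\<close> is $\hat\phi$ for a map $\phi : E_k C \to E_l C$ given on words of length \<open>k\<close>
  by \<open>p\<close>. On $\widehat E C$ it acts termwise on representing sequences.\<close>

definition op_ext ::
    "(int \<Rightarrow> 'c set) \<Rightarrow> nat \<Rightarrow> ('c list \<Rightarrow> 'c list \<Rightarrow>\<^sub>0 real) \<Rightarrow>
      ('c list \<Rightarrow>\<^sub>0 real) \<Rightarrow> ('c list \<Rightarrow>\<^sub>0 real)"
  where "op_ext V k p = tlin (\<lambda>cs. if length cs < k then 0 else
    (\<Sum>\<rho> | \<rho> permutes {..<length cs}.
       (koszul V \<rho> cs / (fact k * fact (length cs - k))) *\<^sub>R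
         tmul (p (take k (permute_list \<rho> cs))) (tw (drop k (permute_list \<rho> cs)))))"

section \<open>Maurer-Cartan elements\<close>

text \<open>$\widehat E C$ is the product of the $\widehat E_q C$ over \<open>q \<ge> 0\<close>, so its elements are given by
  their components. \<open>exp_coeff m j q\<close> is the component in $\widehat E_q C$ of the coefficient of
  $\hbar^j$ in $e^{\mathfrak m}$, $\mathfrak m = \sum \mathfrak m_{\ell,g} \hbar^{g-1}$. The index set is
  finite, because $\ell \ge 1$ bounds the number of factors by \<open>q\<close>.\<close>

definition exp_coeff ::
    "(nat \<Rightarrow> nat \<Rightarrow> nat \<Rightarrow> 'c list \<Rightarrow>\<^sub>0 real) \<Rightarrow> int \<Rightarrow> nat \<Rightarrow> nat \<Rightarrow> 'c list \<Rightarrow>\<^sub>0 real"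
  where "exp_coeff m j q i =
    (\<Sum>ps \<in> {ps. (\<forall>(l, g)\<in>set ps. l \<ge> 1) \<and> (\<Sum>(l, g)\<leftarrow>ps. l) = q \<and> (\<Sum>(l, g)\<leftarrow>ps. int g - 1) = j}.
       (1 / fact (length ps)) *\<^sub>R foldr tmul (map (\<lambda>(l, g). m l g i) ps) (tw []))"

text \<open>\<open>mc_partial V p m j q N\<close> is the component in $\widehat E_q C$ of the coefficient of $\hbar^j$ in
  $\sum_{k,g \le N} \sum_l \hat{\mathfrak p}_{k,l,g} \hbar^{k+g-1} (e^{\mathfrak m})$. As
  $\hat{\mathfrak p}_{k,l,g}$ maps $\widehat E_{q'} C$ to $\widehat E_{q'-k+l} C$ and vanishes for
  \<open>q' < k\<close>, only \<open>l \<le> q\<close> and \<open>q' = q + k - l\<close> contribute.\<close>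

definition mc_partial ::
    "(int \<Rightarrow> 'c set) \<Rightarrow> (nat \<Rightarrow> nat \<Rightarrow> nat \<Rightarrow> 'c list \<Rightarrow> 'c list \<Rightarrow>\<^sub>0 real) \<Rightarrow>
      (nat \<Rightarrow> nat \<Rightarrow> nat \<Rightarrow> 'c list \<Rightarrow>\<^sub>0 real) \<Rightarrow> int \<Rightarrow> nat \<Rightarrow> nat \<Rightarrow> nat \<Rightarrow> 'c list \<Rightarrow>\<^sub>0 real"
  where "mc_partial V p m j q N i =
    (\<Sum>k=1..N. \<Sum>l=1..q. \<Sum>g\<le>N.
       op_ext V k (p k l g) (exp_coeff m (j - (int k + int g - 1)) (q + k - l) i))"

definition euler_char :: "nat \<Rightarrow> nat \<Rightarrow> nat \<Rightarrow> int"
  where "euler_char k l g = 2 - 2 * int g - int k - int l"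

text \<open>\<open>maurer_cartan C F d0 \<gamma> p m\<close>: the collection \<open>m l g\<close> (of representatives of elements of
  $\widehat E_l C$) is a Maurer-Cartan element for the operations \<open>p k l g\<close> of a strict filtered
  $\mathrm{IBL}_\infty$-algebra of bidegree \<open>(d0, \<gamma>)\<close> on the graded space \<open>C\<close> with filtration \<open>F\<close>.
  The last clause says that all components of $\hat{\mathfrak p}(e^{\mathfrak m})$ vanish, the sum over
  \<open>k, l, g\<close> being taken with respect to the filtration.\<close>

definition maurer_cartan ::
    "(int \<Rightarrow> 'c::real_vector set) \<Rightarrow> (real \<Rightarrow> 'c set) \<Rightarrow> int \<Rightarrow> real \<Rightarrow>
      (nat \<Rightarrow> nat \<Rightarrow> nat \<Rightarrow> 'c list \<Rightarrow> 'c list \<Rightarrow>\<^sub>0 real) \<Rightarrow>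
      (nat \<Rightarrow> nat \<Rightarrow> nat \<Rightarrow> 'c list \<Rightarrow>\<^sub>0 real) \<Rightarrow> bool"
  where "maurer_cartan C F d0 \<gamma> p m \<longleftrightarrow> (let V = shift 1 C in
    (\<forall>l\<ge>1. \<forall>g. m l g \<in> Ehat V F l \<and>
       Ehat_degree V F l (- 2 * d0 * (int g - 1)) (m l g) \<and>
       norm_ge V F l (\<gamma> * euler_char 0 l g) (m l g)) \<and>
    norm_gt V F 1 (\<gamma> * euler_char 0 1 0) (m 1 0) \<and>
    norm_gt V F 2 (\<gamma> * euler_char 0 2 0) (m 2 0) \<and>
    (\<forall>j q lam. \<forall>\<^sub>F N in sequentially. norm_ge V F q lam (mc_partial V p m j q N)))"

section \<open>The dual cyclic bar complex\<close>

text \<open>$B_k^{\mathrm{cyc}*} A$: functionals on the quotient of $A[1]^{\otimes k}$ by signed cyclic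
  permutations, i.e. multilinear functions that are invariant under them (extended by 0 to
  lists of other lengths).\<close>

definition Bcyc :: "(int \<Rightarrow> 'a::real_vector set) \<Rightarrow> nat \<Rightarrow> ('a list \<Rightarrow> real) set"
  where "Bcyc G k = {\<phi>. (\<forall>xs. length xs \<noteq> k \<longrightarrow> \<phi> xs = 0) \<and> multilinear k \<phi> \<and>
    (\<forall>x xs. length xs + 1 = k \<longrightarrow> set (x # xs) \<subseteq> homog G \<longrightarrow>
       \<phi> (xs @ [x]) = ksign (sdeg G x * wdeg G xs) * \<phi> (x # xs))}"

definition Bcyc_filt :: "(int \<Rightarrow> 'a::real_vector set) \<Rightarrow> real \<Rightarrow> ('a list \<Rightarrow> real) set"
  where "Bcyc_filt G lam = span (\<Union>k\<in>{k. 1 \<le> k \<and> lam \<le> real k}. Bcyc G k)"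

definition Bcyc_all :: "(int \<Rightarrow> 'a::real_vector set) \<Rightarrow> ('a list \<Rightarrow> real) set"
  where "Bcyc_all G = span (\<Union>k\<in>{1..}. Bcyc G k)"

definition Bcyc_deg :: "(int \<Rightarrow> 'a::real_vector set) \<Rightarrow> int \<Rightarrow> ('a list \<Rightarrow> real) set"
  where "Bcyc_deg G D = {\<phi> \<in> Bcyc_all G.
    \<forall>xs. set xs \<subseteq> homog G \<longrightarrow> wdeg G xs \<noteq> D \<longrightarrow> \<phi> xs = 0}"

definition bar_C :: "nat \<Rightarrow> (int \<Rightarrow> 'a::real_vector set) \<Rightarrow> int \<Rightarrow> ('a list \<Rightarrow> real) set"
  where "bar_C n G = shift (2 - int n) (Bcyc_deg G)"

text \<open>In the next two definitions \<open>i\<close> is $c-1$ and \<open>i'\<close> is $c'-1$, so that \<open>rotate i xs\<close> is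
  $x_c,\dots,x_{c-1}$; the double sum of $|x_r||x_s|$ over $r < c \le s$ is a product of two word
  degrees. Summing over \<open>k1\<close> covers all components of \<open>\<phi>\<close> and \<open>\<psi>\<close>, as these vanish
  on words of the wrong length.\<close>

definition bar_mu ::
    "(int \<Rightarrow> 'a::real_vector set) \<Rightarrow> ('a \<Rightarrow> 'a \<Rightarrow> real) \<Rightarrow> 'a set \<Rightarrow>
      ('a list \<Rightarrow> real) \<Rightarrow> ('a list \<Rightarrow> real) \<Rightarrow> 'a list \<Rightarrow> real"
  where "bar_mu G pr E \<phi> \<psi> = mlext G (\<lambda>xs. \<Sum>k1\<le>length xs. \<Sum>a\<in>E. \<Sum>b\<in>E. \<Sum>i<length xs.
    ksign (sdeg G a + wdeg G (take i xs) * wdeg G (drop i xs) + sdeg G b * wdeg G (take k1 (rotate i xs)))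
      * ginv pr E a b * \<phi> (a # take k1 (rotate i xs)) * \<psi> (b # drop k1 (rotate i xs)))"

definition bar_delta ::
    "(int \<Rightarrow> 'a::real_vector set) \<Rightarrow> ('a \<Rightarrow> 'a \<Rightarrow> real) \<Rightarrow> 'a set \<Rightarrow>
      ('a list \<Rightarrow> real) \<Rightarrow> 'a list \<Rightarrow> 'a list \<Rightarrow> real"
  where "bar_delta G pr E \<phi> xs ys =
    (\<Sum>a\<in>E. \<Sum>b\<in>E. \<Sum>i<length xs. \<Sum>i'<length ys.
      ksign (sdeg G a + wdeg G (take i xs) * wdeg G (drop i xs)
          + wdeg G (take i' ys) * wdeg G (drop i' ys) + sdeg G b * wdeg G xs)
        * ginv pr E a b * \<phi> (a # rotate i xs @ b # rotate i' ys))"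

definition bar_p110 ::
    "(int \<Rightarrow> 'a::real_vector set) \<Rightarrow> ('a \<Rightarrow> 'a) \<Rightarrow> ('a list \<Rightarrow> real) \<Rightarrow> 'a list \<Rightarrow> real"
  where "bar_p110 G d \<phi> = mlext G (\<lambda>xs. \<Sum>j<length xs.
    ksign (wdeg G (take j xs)) * \<phi> (xs[j := d (xs ! j)]))"

definition bar_p210 ::
    "nat \<Rightarrow> (int \<Rightarrow> 'a::real_vector set) \<Rightarrow> ('a \<Rightarrow> 'a \<Rightarrow> real) \<Rightarrow> 'a set \<Rightarrow>
      ('a list \<Rightarrow> real) \<Rightarrow> ('a list \<Rightarrow> real) \<Rightarrow> 'a list \<Rightarrow> real"
  where "bar_p210 n G pr E \<phi> \<psi> =
    ksign ((int n - 3) * hdeg (Bcyc_deg G) \<phi>) *\<^sub>R bar_mu G pr E \<phi> \<psi>"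

text \<open>An element of a tensor product of two spaces $B_{k_i}^{\mathrm{cyc}*} A$ is determined by its
  values on pairs of words, where $(\phi \otimes \psi)(x, y) = \phi(x)\psi(y)$; conversely, for
  finite dimensional $A$ every bilinear form on pairs of cyclic words arises in this way.
  So \<open>bar_p120\<close> picks a representative of an element that is uniquely determined.\<close>

definition teval :: "(('a list \<Rightarrow> real) list \<Rightarrow>\<^sub>0 real) \<Rightarrow> 'a list \<Rightarrow> 'a list \<Rightarrow> real"
  where "teval t xs ys = tlin (\<lambda>cs. (cs ! 0) xs * (cs ! 1) ys) t"

definition bar_p120 ::
    "nat \<Rightarrow> (int \<Rightarrow> 'a::real_vector set) \<Rightarrow> ('a \<Rightarrow> 'a \<Rightarrow> real) \<Rightarrow> 'a set \<Rightarrow>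
      ('a list \<Rightarrow> real) \<Rightarrow> ('a list \<Rightarrow> real) list \<Rightarrow>\<^sub>0 real"
  where "bar_p120 n G pr E \<phi> = (SOME t. t \<in> span (tw ` words (shift 1 (bar_C n G)) 2) \<and>
    (\<forall>xs ys. set xs \<subseteq> homog G \<longrightarrow> set ys \<subseteq> homog G \<longrightarrow>
       teval t xs ys = 1 / 2 * ksign ((int n - 3) * wdeg G xs) * bar_delta G pr E \<phi> xs ys))"

definition bar_ops ::
    "nat \<Rightarrow> (int \<Rightarrow> 'a::real_vector set) \<Rightarrow> ('a \<Rightarrow> 'a \<Rightarrow> real) \<Rightarrow> ('a \<Rightarrow> 'a) \<Rightarrow> 'a set \<Rightarrow>
      nat \<Rightarrow> nat \<Rightarrow> nat \<Rightarrow> ('a list \<Rightarrow> real) list \<Rightarrow> ('a list \<Rightarrow> real) list \<Rightarrow>\<^sub>0 real"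
  where "bar_ops n G pr d E k l g cs =
    (if (k, l, g) = (1, 1, 0) then tw [bar_p110 G d (cs ! 0)]
     else if (k, l, g) = (2, 1, 0) then tw [bar_p210 n G pr E (cs ! 0) (cs ! 1)]
     else if (k, l, g) = (1, 2, 0) then bar_p120 n G pr E (cs ! 0)
     else 0)"

definition m2_plus ::
    "nat \<Rightarrow> ('a \<Rightarrow> 'a \<Rightarrow> real) \<Rightarrow> ('a list \<Rightarrow> 'a) \<Rightarrow> 'a list \<Rightarrow> real"
  where "m2_plus n pr m2 xs =
    (if length xs = 3 then ksign (int n - 2) * pr (m2 [xs ! 0, xs ! 1]) (xs ! 2) else 0)"

end

theory Submission
  imports Defs
begin

text \<open>Write \<open>\<phi>\<close> for the cyclic cochain \<open>\<plusminus>\<langle>m\<^sub>2(x,y),z\<rangle>\<close>. Since only the component \<open>(1,0)\<close> of the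
collection is nonzero, the exponential is the series of the powers \<open>\<phi>\<^sup>q/q!\<close>, with the \<open>q\<close>-th power in
word length \<open>q\<close>, and each extended operation merely replaces one or two factors \<open>\<phi>\<close> by \<open>p\<^sub>1\<^sub>1\<^sub>0(\<phi>)\<close>,
\<open>p\<^sub>2\<^sub>1\<^sub>0(\<phi>,\<phi>)\<close> or \<open>p\<^sub>1\<^sub>2\<^sub>0(\<phi>)\<close>. All three of these vanish separately, so every term of the
Maurer-Cartan equation is zero in the symmetric algebra before any limit is taken.

Each vanishing is one property of a cyclic DGA. \<open>p\<^sub>1\<^sub>1\<^sub>0(\<phi>) = 0\<close> is the Leibniz rule paired with a third
vector (\<open>p110_m2_plus\<close>). \<open>p\<^sub>1\<^sub>2\<^sub>0(\<phi>) = 0\<close> holds because the cobracket needs cyclic words of length at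
least four (\<open>delta_m2_plus\<close>). For \<open>p\<^sub>2\<^sub>1\<^sub>0(\<phi>,\<phi>)\<close> contracting two copies of \<open>\<phi>\<close> with the inverse of
the pairing gives \<open>\<plusminus>\<langle>m\<^sub>2(x\<^sub>1,x\<^sub>2),m\<^sub>2(x\<^sub>3,x\<^sub>4)\<rangle>\<close> (\<open>contraction_m2_plus\<close>). Of its four cyclic rotations
opposite ones agree, and neighbouring ones cancel, because cyclicity turns them into
\<open>\<langle>m\<^sub>2(m\<^sub>2(x\<^sub>1,x\<^sub>2),x\<^sub>3),x\<^sub>4\<rangle>\<close> and \<open>\<langle>m\<^sub>2(x\<^sub>1,m\<^sub>2(x\<^sub>2,x\<^sub>3)),x\<^sub>4\<rangle>\<close>, up to sign the two sides of
associativity (\<open>mu_m2_plus\<close>).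

One point concerns the encoding of tensors. The value of \<open>p\<^sub>1\<^sub>2\<^sub>0\<close> is a formal combination of words of
which only the evaluation on pairs of cyclic words is known. Concluding from a zero evaluation that
the combination is zero as a tensor is the injectivity of the map from a tensor product of
function spaces to functions of two variables (\<open>tensor_zero\<close>), here in a graded version.\<close>

section \<open>Signs and homogeneous components\<close>

lemma ksign_parity: "ksign k = (if even k then 1 else -1)"
  by (auto simp: power_int_def even_nat_iff uminus_power_if)

lemma hdeg_eq:
  assumes gr: "grading X" and v: "v \<in> X j" "v \<noteq> 0"
  shows "hdeg X v = j"
  unfolding hdeg_def
proof (rule the_equality)
  fix k assume k: "v \<in> X k"
  have zero: "0 \<in> X i" for i
    using gr by (simp add: grading_def subspace_0)
  have dec: "is_decomposition X v (\<lambda>i. if i = l then v else 0)" if "v \<in> X l" for l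
  proof -
    have "{i. (if i = l then v else 0) \<noteq> 0} = {l}" using v by auto
    then show ?thesis using that zero by (auto simp: is_decomposition_def)
  qed
  have "(\<lambda>i. if i = k then v else 0) = (\<lambda>i. if i = j then v else 0)"
    using gr dec[OF v(1)] dec[OF k] unfolding grading_def by blast
  from fun_cong[OF this, of k] show "k = j" using v by (simp split: if_splits)
qed (use v in simp)

lemma hcomp_decomposition: "grading X \<Longrightarrow> is_decomposition X v (hcomp X v)"
  unfolding hcomp_def by (rule theI'[of "is_decomposition X v"]) (simp add: grading_def)

lemma mlext_eq_0:
  assumes gr: "grading X" and F: "\<And>ys. set ys \<subseteq> homog X - {0} \<Longrightarrow> F ys = 0"
  shows "mlext X F xs = 0"
  unfolding mlext_def
proof (intro sum.neutral ballI F)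
  fix ds assume "ds \<in> {ds. list_all2 (\<lambda>x j. hcomp X x j \<noteq> 0) xs ds}"
  then have "\<forall>(x, j) \<in> set (zip xs ds). hcomp X x j \<noteq> 0" by (auto simp: list_all2_iff)
  moreover have "hcomp X x j \<in> X j" for x j
    using hcomp_decomposition[OF gr, of x] by (simp add: is_decomposition_def)
  ultimately show "set (map2 (hcomp X) xs ds) \<subseteq> homog X - {0}"
    by (force simp: homog_def)
qed

lemma wdeg_simps [simp]: "wdeg X [] = 0" "wdeg X (x # xs) = sdeg X x + wdeg X xs"
  by (simp_all add: wdeg_def)

section \<open>Identities in a cyclic DGA\<close>

text \<open>The identities of a cyclic DGA are restated below for \<open>x \<in> G i\<close> with signs in terms of the given \<open>i\<close>
instead of \<open>sdeg G x\<close>. In this form they also hold for the zero vector, so that products such as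
\<open>m 2 [x, y]\<close>, which may vanish, can be substituted into them.\<close>

locale cyclic_dga =
  fixes n :: nat
    and G :: "int \<Rightarrow> 'a::real_vector set"
    and pr :: "'a \<Rightarrow> 'a \<Rightarrow> real"
    and d :: "'a \<Rightarrow> 'a"
    and m :: "nat \<Rightarrow> 'a list \<Rightarrow> 'a"
  assumes cyclic_DGA: "cyclic_DGA n G pr d m"
begin

abbreviation mult :: "'a \<Rightarrow> 'a \<Rightarrow> 'a" where "mult x y \<equiv> m 2 [x, y]"

lemma A_infinity: "cyclic_A_infinity n G pr d m"
  using cyclic_DGA by (simp add: cyclic_DGA_def)

lemma complex: "cyclic_cochain_complex n G pr d"
  using A_infinity by (simp add: cyclic_A_infinity_def)

lemma grading: "grading G"
  using complex by (simp add: cyclic_cochain_complex_def)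

lemma bilinear_pr: "bilinear pr"
  using complex by (simp add: cyclic_cochain_complex_def)

lemma linear_d: "linear d"
  using complex by (simp add: cyclic_cochain_complex_def)

lemma linear_mult: "linear (\<lambda>x. mult x y)" "linear (\<lambda>y. mult x y)"
proof -
  have *: "length us + length vs + 1 = 2 \<Longrightarrow> linear (\<lambda>x. m 2 (us @ x # vs))" for us vs
    using A_infinity by (simp add: cyclic_A_infinity_def multilinear_def)
  show "linear (\<lambda>x. mult x y)" "linear (\<lambda>y. mult x y)"
    using *[of "[]" "[y]"] *[of "[x]" "[]"] by simp_all
qed

lemmas bilinear_simps =
  bilinear_lzero[OF bilinear_pr] bilinear_rzero[OF bilinear_pr]
  bilinear_ladd[OF bilinear_pr] bilinear_radd[OF bilinear_pr]
  bilinear_lneg[OF bilinear_pr] bilinear_rneg[OF bilinear_pr]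
  bilinear_lmul[OF bilinear_pr] bilinear_rmul[OF bilinear_pr]

lemma zero_simps [simp]: "pr 0 x = 0" "pr x 0 = 0" "mult 0 x = 0" "mult x 0 = 0" "d 0 = 0"
  using bilinear_lzero[OF bilinear_pr] bilinear_rzero[OF bilinear_pr]
    linear_0[OF linear_mult(1)] linear_0[OF linear_mult(2)] linear_0[OF linear_d] by simp_all

lemma sdeg_eq: "x \<in> G i \<Longrightarrow> x \<noteq> 0 \<Longrightarrow> sdeg G x = i - 1"
  by (simp add: sdeg_def hdeg_eq[OF grading])

lemma homogI: "x \<in> G i \<Longrightarrow> x \<in> homog G"
  by (auto simp: homog_def)

lemma pr_degree: "x \<in> G i \<Longrightarrow> y \<in> G j \<Longrightarrow> pr x y \<noteq> 0 \<Longrightarrow> i + j = int n"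
  using complex unfolding cyclic_cochain_complex_def by blast

lemma mult_degree:
  assumes "x \<in> G i" "y \<in> G j"
  shows "mult x y \<in> G (i + j)"
proof -
  have "\<forall>xs ds. length xs = 2 \<longrightarrow> list_all2 (\<lambda>x j. x \<in> G j) xs ds \<longrightarrow>
       m 2 xs \<in> G ((\<Sum>j\<leftarrow>ds. j - 1) + 2)"
    using A_infinity unfolding cyclic_A_infinity_def by simp
  then have "mult x y \<in> G ((\<Sum>j\<leftarrow>[i, j]. j - 1) + 2)" 
    using assms by (metis length_Cons list.size(3) list_all2_Cons list_all2_Nil numeral_2_eq_2)
  then show ?thesis by simp
qed

lemma pr_swap:
  assumes "x \<in> G i" "y \<in> G j"
  shows "pr x y = - ksign ((i - 1) * (j - 1)) * pr y x"
proof (cases "x = 0 \<or> y = 0")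
  case False
  have "pr x y + ksign (sdeg G x * sdeg G y) * pr y x = 0"
    using complex assms[THEN homogI] by (simp add: cyclic_cochain_complex_def)
  then show ?thesis using False assms by (simp add: sdeg_eq)
qed auto

lemma pr_d:
  assumes "x \<in> G i" "y \<in> G j"
  shows "pr (d x) y = - ksign (i - 1) * pr x (d y)"
proof (cases "x = 0")
  case False
  have "pr (d x) y + ksign (sdeg G x) * pr x (d y) = 0"
    using complex assms[THEN homogI] by (simp add: cyclic_cochain_complex_def)
  then show ?thesis using False assms by (simp add: sdeg_eq)
qed auto

lemma pr_mult_rotate:
  assumes "x \<in> homog G" "y \<in> homog G" "z \<in> homog G"
  shows "pr (mult x y) z = ksign (sdeg G z * (sdeg G x + sdeg G y)) * pr (mult z x) y"
proof -
  have "\<forall>z\<in>homog G. \<forall>xs. length xs = 2 \<longrightarrow> set xs \<subseteq> homog G \<longrightarrow>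
       pr (m 2 xs) z = ksign (sdeg G z * wdeg G xs) * pr (m 2 (z # butlast xs)) (last xs)"
    using A_infinity by (simp add: cyclic_A_infinity_def)
  from this[rule_format, of z "[x, y]"] show ?thesis using assms by simp
qed

lemma pr_mult_cyclic:
  assumes "x \<in> G i" "y \<in> G j" "z \<in> G k"
  shows "pr (mult x y) z = ksign ((k - 1) * (i + j)) * pr (mult z x) y"
proof (cases "x = 0 \<or> y = 0 \<or> z = 0")
  case False
  then have "pr (mult x y) z = ksign ((k - 1) * (i - 1 + (j - 1))) * pr (mult z x) y"
    using pr_mult_rotate[OF assms[THEN homogI]] assms by (simp add: sdeg_eq)
  moreover have "(k - 1) * (i - 1 + (j - 1)) = (k - 1) * (i + j) - 2 * (k - 1)"
    by (simp add: algebra_simps)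
  ultimately show ?thesis by (simp add: ksign_parity)
qed auto

lemma A_infinity_relation:
  assumes "r \<ge> 1" "length xs = r" "set xs \<subseteq> homog G"
  shows "(\<Sum>l=1..r. \<Sum>i\<le>r - l. ksign (wdeg G (take i xs)) *\<^sub>R
          m (r + 1 - l) (take i xs @ m l (take l (drop i xs)) # drop (i + l) xs)) = 0"
  using A_infinity assms unfolding cyclic_A_infinity_def by blast

lemma m_1: "m (Suc 0) [x] = d x"
  using A_infinity by (simp add: cyclic_A_infinity_def)

lemma m_3: "m 3 [x, y, z] = 0"
  using cyclic_DGA by (simp add: cyclic_DGA_def)

lemma leibniz:
  assumes "x \<in> G i" "y \<in> G j"
  shows "mult (d x) y + ksign (i - 1) *\<^sub>R mult x (d y) + d (mult x y) = 0"
proof (cases "x = 0")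
  case False
  have 1: "{Suc 0..2} = {1, 2}" and 2: "{..Suc 0} = {0, 1}" by auto
  show ?thesis
    using A_infinity_relation[of 2 "[x, y]"] assms[THEN homogI] False assms
    by (simp add: 1 2 m_1 sdeg_eq numeral_eq_Suc)
qed auto

lemma mult_assoc:
  assumes "x \<in> G i" "y \<in> G j" "z \<in> G k"
  shows "mult (mult x y) z + ksign (i - 1) *\<^sub>R mult x (mult y z) = 0"
proof (cases "x = 0")
  case False
  have 1: "{Suc 0..3} = {1, 2, 3}" and 2: "{..Suc 0} = {0, 1}" and 3: "{..2} = {0, 1, 2::nat}" by auto
  show ?thesis
    using A_infinity_relation[of 3 "[x, y, z]"] assms[THEN homogI] False assms
    by (simp add: 1 2 3 m_1 m_3[unfolded numeral_3_eq_3] sdeg_eq numeral_eq_Suc)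
qed auto

end

section \<open>Contraction with the inverse pairing\<close>

text \<open>Every vector has the expansion \<open>w = \<Sum>\<^sub>a \<langle>e\<^sub>a,w\<rangle> e\<^sup>a\<close> in the dual basis; inserting it on both sides of
\<open>\<langle>u,v\<rangle>\<close> gives the formula. That the dual basis exists is nondegeneracy together with a dimension
count: the map \<open>v \<mapsto> \<Sum>\<^sub>a \<langle>e\<^sub>a,v\<rangle> e\<^sub>a\<close> is injective, hence surjective.\<close>

lemma ginv_contraction:
  fixes pr :: "'a::real_vector \<Rightarrow> 'a \<Rightarrow> real"
  assumes bil: "bilinear pr" and nondeg: "\<forall>y. (\<forall>x. pr x y = 0) \<longrightarrow> y = 0"
    and fin: "finite E" and ind: "independent E" and sp: "span E = UNIV"
  shows "(\<Sum>a\<in>E. \<Sum>b\<in>E. ginv pr E a b * (pr a u * pr b v)) = pr u v"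
proof -
  have lin1: "linear (\<lambda>x. pr x y)" and lin2: "linear (\<lambda>y. pr x y)" for x y
    using bil by (simp_all add: bilinear_def)
  have eq0: "y = 0" if "\<And>a. a \<in> E \<Longrightarrow> pr a y = 0" for y
  proof -
    have "pr x y = 0" for x
      using linear_eq_0_on_span[OF lin1, of E y x] that sp by simp
    then show ?thesis using nondeg by blast
  qed
  have coeff0: "f a = 0" if "(\<Sum>a\<in>E. f a *\<^sub>R a) = 0" "a \<in> E" for f a
    using independentD[OF ind fin order_refl that(1)] that(2) .
  interpret fd: finite_dimensional_vector_space "scaleR :: real \<Rightarrow> 'a \<Rightarrow> 'a" E
    using fin ind sp
    by unfold_locales (simp_all add: dependent_raw_def span_raw_def)
  define T where "T = (\<lambda>v. \<Sum>a\<in>E. pr a v *\<^sub>R a)"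
  have lin_T: "linear T"
    unfolding T_def
    by (rule linearI) (simp_all add: linear_add[OF lin2] linear_scale[OF lin2]
        scaleR_add_left sum.distrib scaleR_sum_right)
  have "inj T"
    unfolding linear_injective_0[OF lin_T]
  proof (intro allI impI)
    fix v assume "T v = 0"
    then show "v = 0" using coeff0[of "\<lambda>a. pr a v"] by (intro eq0) (simp add: T_def)
  qed
  then have "surj T"
    using fd.linear_inj_imp_surj[of T] lin_T by (simp add: linear_def)
  have dual: "pr c (dual_vec pr E b) = (if c = b then 1 else 0)" if b: "b \<in> E" and c: "c \<in> E" for b c
  proof -
    obtain w where w: "T w = b" using \<open>surj T\<close> by (metis surjD)
    have "(\<Sum>a\<in>E. (pr a w - (if a = b then 1 else 0)) *\<^sub>R a) = T w - b"
      using b fin by (simp add: T_def scaleR_diff_left sum_subtractf if_distrib[of "\<lambda>r. r *\<^sub>R _"] sum.delta cong: if_cong)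
    then have ex: "\<forall>a\<in>E. pr a w = (if a = b then 1 else 0)"
      using coeff0[of "\<lambda>a. pr a w - (if a = b then 1 else 0)"] w by simp
    have "\<forall>a\<in>E. pr a (dual_vec pr E b) = (if a = b then 1 else 0)"
      unfolding dual_vec_def
    proof (rule theI[of _ w])
      fix y assume y: "\<forall>a\<in>E. pr a y = (if a = b then 1 else 0)"
      have "y - w = 0" 
        by (rule eq0) (simp add: linear_diff[OF lin2] y ex)
      then show "y = w" by simp
    qed (rule ex)
    then show ?thesis using c by blast
  qed
  have expand: "w = (\<Sum>a\<in>E. pr a w *\<^sub>R dual_vec pr E a)" for w
  proof -
    have "w - (\<Sum>a\<in>E. pr a w *\<^sub>R dual_vec pr E a) = 0"
      by (rule eq0) (simp add: linear_diff[OF lin2] linear_sum[OF lin2] linear_scale[OF lin2] dual fin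
          if_distrib[of "\<lambda>r. _ * r"] sum.delta cong: if_cong)
    then show ?thesis by simp
  qed
  have "pr u v = pr (\<Sum>a\<in>E. pr a u *\<^sub>R dual_vec pr E a) (\<Sum>b\<in>E. pr b v *\<^sub>R dual_vec pr E b)"
    using expand by simp
  also have "\<dots> = (\<Sum>a\<in>E. \<Sum>b\<in>E. pr a u * (pr b v * ginv pr E a b))"
    by (simp add: linear_sum[OF lin1] linear_scale[OF lin1])
      (simp add: linear_sum[OF lin2] linear_scale[OF lin2] ginv_def sum_distrib_left)
  finally show ?thesis by (simp add: mult_ac)
qed

section \<open>The cyclic cochain of the product\<close>

context cyclic_dga
begin

abbreviation \<phi> :: "'a list \<Rightarrow> real" where "\<phi> \<equiv> m2_plus n pr (m 2)"

lemma m2_plus_3: "\<phi> [x, y, z] = ksign (int n - 2) * pr (mult x y) z"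
  by (simp add: m2_plus_def)

lemma m2_plus_other: "length xs \<noteq> 3 \<Longrightarrow> \<phi> xs = 0"
  by (simp add: m2_plus_def)

lemma length_3E:
  assumes "length xs = 3" obtains x y z where "xs = [x, y, z]"
  using assms by (auto simp: numeral_3_eq_3 length_Suc_conv)

lemma m2_plus_multilinear: "multilinear 3 \<phi>"
  unfolding multilinear_def
proof (intro allI impI)
  fix us vs :: "'a list" assume len: "length us + length vs + 1 = 3"
  from len consider y z where "us = []" "vs = [y, z]" | x z where "us = [x]" "vs = [z]"
    | x y where "us = [x, y]" "vs = []"
    by (cases us rule: remdups_adj.cases; cases vs rule: remdups_adj.cases) auto
  then show "linear (\<lambda>x. \<phi> (us @ x # vs))"
    by cases (rule linearI; simp add: m2_plus_3 bilinear_simps algebra_simps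
        linear_add[OF linear_mult(1)] linear_add[OF linear_mult(2)]
        linear_scale[OF linear_mult(1)] linear_scale[OF linear_mult(2)])+
qed

lemma m2_plus_Bcyc: "\<phi> \<in> Bcyc G 3"
proof -
  have "\<phi> (xs @ [x]) = ksign (sdeg G x * wdeg G xs) * \<phi> (x # xs)"
    if len: "length xs + 1 = 3" and hom: "set (x # xs) \<subseteq> homog G" for x xs
  proof -
    from len obtain y z where xs: "xs = [y, z]" by (auto simp: numeral_3_eq_3 length_Suc_conv)
    show ?thesis using hom pr_mult_rotate[of y z x] by (simp add: xs m2_plus_3)
  qed
  then show ?thesis using m2_plus_other m2_plus_multilinear unfolding Bcyc_def by blast
qed

text \<open>The pairing has degree \<open>-n\<close> and the product degree \<open>1\<close> on \<open>A[1]\<close>; the three shifts by one turn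
\<open>n\<close> into \<open>n - 3\<close>.\<close>

lemma m2_plus_degree: "\<phi> \<in> Bcyc_deg G (int n - 3)"
  unfolding Bcyc_deg_def
proof (intro CollectI conjI allI impI)
  show "\<phi> \<in> Bcyc_all G"
    unfolding Bcyc_all_def by (rule span_base) (use m2_plus_Bcyc in force)
  fix xs assume xs: "set xs \<subseteq> homog G" and deg: "wdeg G xs \<noteq> int n - 3"
  show "\<phi> xs = 0"
  proof (rule ccontr)
    assume nz: "\<phi> xs \<noteq> 0"
    then obtain x y z where [simp]: "xs = [x, y, z]"
      using m2_plus_other[of xs] length_3E[of xs] by blast
    obtain i j k where ijk: "x \<in> G i" "y \<in> G j" "z \<in> G k"
      using xs by (auto simp: homog_def)
    have pr_nz: "pr (mult x y) z \<noteq> 0" using nz by (simp add: m2_plus_3)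
    then have "x \<noteq> 0" "y \<noteq> 0" "z \<noteq> 0" by auto
    then show False
      using deg pr_degree[OF mult_degree[OF ijk(1,2)] ijk(3) pr_nz]
      by (simp add: sdeg_eq[OF ijk(1)] sdeg_eq[OF ijk(2)] sdeg_eq[OF ijk(3)])
  qed
qed

text \<open>Pairing the Leibniz rule for \<open>m 2 [x, y]\<close> with \<open>z\<close> yields the three terms of the differential of
the cochain: the term in which \<open>d\<close> falls on the product is moved to \<open>z\<close> by compatibility of \<open>d\<close>
with the pairing.\<close>

lemma p110_m2_plus: "bar_p110 G d \<phi> = 0"
proof (rule ext)
  fix xs
  show "bar_p110 G d \<phi> xs = 0 xs"
    unfolding bar_p110_def zero_fun_def
  proof (rule mlext_eq_0[OF grading])
    fix ys assume hom: "set ys \<subseteq> homog G - {0}"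
    show "(\<Sum>j<length ys. ksign (wdeg G (take j ys)) * \<phi> (ys[j := d (ys ! j)])) = 0"
    proof (cases "length ys = 3")
      case True
      then obtain x y z where ys: "ys = [x, y, z]" by (rule length_3E)
      obtain i j k where deg: "x \<in> G i" "y \<in> G j" "z \<in> G k"
        using hom ys by (auto simp: homog_def)
      have sdeg: "sdeg G x = i - 1" "sdeg G y = j - 1"
        using hom deg by (simp_all add: sdeg_eq ys)
      have "pr (mult (d x) y + ksign (i - 1) *\<^sub>R mult x (d y) + d (mult x y)) z = 0"
        using leibniz[OF deg(1,2)] by simp
      then have "pr (mult (d x) y) z + ksign (i - 1) * pr (mult x (d y)) z
          - ksign (i + j - 1) * pr (mult x y) (d z) = 0"
        using pr_d[OF mult_degree[OF deg(1,2)] deg(3)] by (simp add: bilinear_simps)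
      moreover have "ksign (i - 1 + (j - 1)) = - ksign (i + j - 1)"
        by (simp add: ksign_parity)
      moreover have "{..<Suc (Suc (Suc 0))} = {0, 1, 2}" by auto
      ultimately have "ksign (int n - 2) * (pr (mult (d x) y) z + ksign (i - 1) * pr (mult x (d y)) z
          + ksign (i - 1 + (j - 1)) * pr (mult x y) (d z)) = 0"
         by simp
      then show ?thesis
        by (simp add: ys m2_plus_3 sdeg lessThan_Suc algebra_simps)
    qed (simp add: m2_plus_other)
  qed
qed

text \<open>Antisymmetry brings the second product to the front, and cyclicity, with \<open>m 2 [x, y]\<close> as the
rotated argument, then moves the first product into it.\<close>

lemma pr_mult_mult:
  assumes "x \<in> G i" "y \<in> G j" "z \<in> G k" "w \<in> G l"
  shows "pr (mult x y) (mult z w) = ksign (i + j) * pr (mult (mult x y) z) w"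
proof -
  note xy = mult_degree[OF assms(1,2)] and zw = mult_degree[OF assms(3,4)]
  have "pr (mult x y) (mult z w)
      = - ksign ((i + j - 1) * (k + l - 1)) * pr (mult z w) (mult x y)"
    using pr_swap[OF xy zw] .
  also have "pr (mult z w) (mult x y) = ksign ((i + j - 1) * (k + l)) * pr (mult (mult x y) z) w"
    using pr_mult_cyclic[OF assms(3,4) xy] .
  also have "- ksign ((i + j - 1) * (k + l - 1)) * (ksign ((i + j - 1) * (k + l)) * pr (mult (mult x y) z) w)
     = ksign (i + j) * pr (mult (mult x y) z) w"
    by (simp add: ksign_parity)
  finally show ?thesis .
qed

end

locale cyclic_dga_basis = cyclic_dga n G pr d m for n :: nat
    and G :: "int \<Rightarrow> 'a::real_vector set" and pr d m +
  fixes E :: "'a set"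
  assumes finite_dimensional: "\<exists>S::'a set. finite S \<and> span S = UNIV"
    and basis: "homogeneous_basis G E"
begin

lemma finite_E: "finite E"
proof -
  obtain S :: "'a set" where "finite S" "span S = UNIV" using finite_dimensional by blast
  then show ?thesis
    using basis real_vector.independent_span_bound[of S E] by (simp add: homogeneous_basis_def)
qed

lemma contraction: "(\<Sum>a\<in>E. \<Sum>b\<in>E. ginv pr E a b * (pr a u * pr b v)) = pr u v"
  using complex basis finite_E
  by (intro ginv_contraction) (simp_all add: cyclic_cochain_complex_def homogeneous_basis_def)

text \<open>Cyclicity rewrites the two copies of the cochain as \<open>\<plusminus>\<langle>e\<^sub>a,m\<^sub>2(x,y)\<rangle>\<close> and \<open>\<plusminus>\<langle>e\<^sub>b,m\<^sub>2(z,w)\<rangle>\<close>,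
after which the contraction formula applies, because the total sign does not depend on the basis
vectors. The degree of \<open>e\<^sub>a\<close> cancels from it, and that of \<open>e\<^sub>b\<close> is
determined by \<open>z\<close> and \<open>w\<close> whenever the summand is nonzero. The parameter \<open>r\<close> stands for the sign
of a rotation.\<close>

lemma contraction_m2_plus:
  assumes deg: "x \<in> G i" "y \<in> G j" "z \<in> G k" "w \<in> G l"
  shows "(\<Sum>a\<in>E. \<Sum>b\<in>E. ksign (sdeg G a + r + sdeg G b * (i - 1 + (j - 1))) * ginv pr E a b *
            \<phi> [a, x, y] * \<phi> [b, z, w])
    = ksign (r + (i + j + 1)) * pr (mult x y) (mult z w)" (is "?L = ?R")
proof -
  have leg: "\<phi> [a, x, y] = - ksign (int n - 2) * ksign (sdeg G a) * pr a (mult x y)"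
    if a: "a \<in> E" and deg: "x \<in> G i" "y \<in> G j" for a x y i j
  proof -
    obtain k where k: "a \<in> G k" using a basis by (auto simp: homogeneous_basis_def homog_def)
    have "a \<noteq> 0" using a basis dependent_zero by (auto simp: homogeneous_basis_def)
    have "pr (mult x y) a = ksign ((k - 1) * (i + j)) * pr (mult a x) y"
      using pr_mult_cyclic[OF deg k] .
    moreover have "pr (mult x y) a = - ksign ((i + j - 1) * (k - 1)) * pr a (mult x y)"
      using pr_swap[OF mult_degree[OF deg] k] .
    ultimately show ?thesis
      unfolding m2_plus_3 sdeg_eq[OF k \<open>a \<noteq> 0\<close>]
      by (cases "even i"; cases "even j"; cases "even k") (simp_all add: ksign_parity)
  qed
  have summand: "ksign (sdeg G a + r + sdeg G b * (i - 1 + (j - 1))) * ginv pr E a b * \<phi> [a, x, y] * \<phi> [b, z, w]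
     = ksign (r + (int n - 1 - (k + l)) * (i + j + 1)) * (ginv pr E a b * (pr a (mult x y) * pr b (mult z w)))"
    if a: "a \<in> E" and b: "b \<in> E" for a b
  proof (cases "pr b (mult z w) = 0")
    case True
    then show ?thesis using leg[OF b deg(3,4)] by simp
  next
    case False
    obtain q where q: "b \<in> G q" using b basis by (auto simp: homogeneous_basis_def homog_def)
    have "b \<noteq> 0" using False by auto
    then have b: "sdeg G b = int n - 1 - (k + l)"
      using pr_degree[OF q mult_degree[OF deg(3,4)] False] sdeg_eq[OF q] by simp
    show ?thesis
      unfolding leg[OF a deg(1,2)] leg[OF \<open>b \<in> E\<close> deg(3,4)] b
      by (cases "even i"; cases "even j") (simp_all add: ksign_parity)
  qed
  have "?L = ksign (r + (int n - 1 - (k + l)) * (i + j + 1)) * pr (mult x y) (mult z w)"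
    unfolding contraction[of "mult x y" "mult z w", symmetric] sum_distrib_left
    by (intro sum.cong refl summand)
  also have "\<dots> = ?R"
  proof (cases "pr (mult x y) (mult z w) = 0")
    case False
    have eq: "int n - 1 - (k + l) = i + j - 1"
      using pr_degree[OF mult_degree[OF deg(1,2)] mult_degree[OF deg(3,4)] False] by simp
    show ?thesis
      unfolding eq by (cases "even i"; cases "even j") (simp_all add: ksign_parity)
  qed simp
  finally show ?thesis .
qed

text \<open>Only words of length four, cut in the middle, contribute, and there are four rotations of such a
word. All four pairings are multiples of \<open>\<langle>m\<^sub>2(x,m\<^sub>2(y,z)),w\<rangle>\<close>, by associativity or by cyclicity, and
the signs cancel.\<close>

lemma mu_m2_plus: "bar_mu G pr E \<phi> \<phi> = 0"
proof (rule ext)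
  fix xs
  show "bar_mu G pr E \<phi> \<phi> xs = 0 xs"
    unfolding bar_mu_def zero_fun_def
  proof (rule mlext_eq_0[OF grading])
    fix ys assume hom: "set ys \<subseteq> homog G - {0}"
    define t where "t k1 a b i = ksign (sdeg G a + wdeg G (take i ys) * wdeg G (drop i ys)
          + sdeg G b * wdeg G (take k1 (rotate i ys)))
        * ginv pr E a b * \<phi> (a # take k1 (rotate i ys)) * \<phi> (b # drop k1 (rotate i ys))"
      for k1 a b i
    have t0: "t k1 a b i = 0" if "k1 \<noteq> 2 \<or> length ys \<noteq> 4" "k1 \<le> length ys" for k1 a b i
      using that m2_plus_other[of "a # take k1 (rotate i ys)"] m2_plus_other[of "b # drop k1 (rotate i ys)"]
      by (cases "k1 = 2") (auto simp: t_def)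
    have "(\<Sum>k1\<le>length ys. \<Sum>a\<in>E. \<Sum>b\<in>E. \<Sum>i<length ys. t k1 a b i) = 0"
    proof (cases "length ys = 4")
      case True
      then obtain x y z w where ys: "ys = [x, y, z, w]"
        by (auto simp: numeral_eq_Suc length_Suc_conv)
      obtain i j k l where deg: "x \<in> G i" "y \<in> G j" "z \<in> G k" "w \<in> G l"
        using hom ys by (auto simp: homog_def)
      have sdeg: "sdeg G x = i - 1" "sdeg G y = j - 1" "sdeg G z = k - 1" "sdeg G w = l - 1"
        using hom deg by (simp_all add: sdeg_eq ys)
      \<comment> \<open>Collect the terms by rotation: \<open>s c\<close> belongs to the word rotated by \<open>c\<close>.\<close>
      define s where "s c = (\<Sum>a\<in>E. \<Sum>b\<in>E. t 2 a b c)" for c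
      have "(\<Sum>k1\<le>length ys. \<Sum>a\<in>E. \<Sum>b\<in>E. \<Sum>i<length ys. t k1 a b i)
          = (\<Sum>k1\<in>{2}. \<Sum>a\<in>E. \<Sum>b\<in>E. \<Sum>i<length ys. t k1 a b i)"
        by (rule sum.mono_neutral_right) (auto simp: True t0)
      also have "\<dots> = (\<Sum>c<4. s c)"
        unfolding s_def True by (simp add: sum.swap[of _ "{..<4::nat}"])
      also have "\<dots> = s 0 + s 1 + s 2 + s 3"
        by (simp add: numeral_eq_Suc)
      also have "\<dots> = 0"
      proof -
        have s: "s 0 = ksign (i + j + 1) * pr (mult x y) (mult z w)"
          "s 1 = ksign ((i - 1) * (j - 1 + (k - 1 + (l - 1))) + (j + k + 1)) * pr (mult y z) (mult w x)"
          "s 2 = ksign ((i - 1 + (j - 1)) * (k - 1 + (l - 1)) + (k + l + 1)) * pr (mult z w) (mult x y)"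
          "s 3 = ksign ((i - 1 + (j - 1 + (k - 1))) * (l - 1) + (l + i + 1)) * pr (mult w x) (mult y z)"
          using contraction_m2_plus[OF deg, of 0]
            contraction_m2_plus[OF deg(2,3,4,1), of "(i - 1) * (j - 1 + (k - 1 + (l - 1)))"]
            contraction_m2_plus[OF deg(3,4,1,2), of "(i - 1 + (j - 1)) * (k - 1 + (l - 1))"]
            contraction_m2_plus[OF deg(4,1,2,3), of "(i - 1 + (j - 1 + (k - 1))) * (l - 1)"]
          by (simp_all add: s_def t_def ys sdeg numeral_eq_Suc)
        have "pr (mult (mult x y) z + ksign (i - 1) *\<^sub>R mult x (mult y z)) w = 0"
          using mult_assoc[OF deg(1,2,3)] by simp
        then have assoc: "pr (mult (mult x y) z) w = - ksign (i - 1) * pr (mult x (mult y z)) w"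
          by (simp add: bilinear_simps)
        have "pr (mult x y) (mult z w) = - ksign (i + j) * ksign (i - 1) * pr (mult x (mult y z)) w"
          using pr_mult_mult[OF deg] assoc by simp
        moreover have "pr (mult y z) (mult w x)
            = ksign (j + k) * (ksign ((i - 1) * (j + k + l)) * pr (mult x (mult y z)) w)"
          using pr_mult_mult[OF deg(2,3,4,1)]
            pr_mult_cyclic[OF mult_degree[OF deg(2,3)] deg(4,1)] by simp
        moreover have "pr (mult z w) (mult x y)
            = - ksign ((k + l - 1) * (i + j - 1)) * pr (mult x y) (mult z w)"
          using pr_swap[OF mult_degree[OF deg(3,4)] mult_degree[OF deg(1,2)]] .
        moreover have "pr (mult w x) (mult y z)
            = - ksign ((l + i - 1) * (j + k - 1)) * pr (mult y z) (mult w x)"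
          using pr_swap[OF mult_degree[OF deg(4,1)] mult_degree[OF deg(2,3)]] .
        ultimately show ?thesis
          unfolding s
          by (cases "even i"; cases "even j"; cases "even k"; cases "even l") (simp_all add: ksign_parity)
      qed
      finally show ?thesis .
    qed (simp add: t0)
    then show "(\<Sum>k1\<le>length ys. \<Sum>a\<in>E. \<Sum>b\<in>E. \<Sum>i<length ys.
        ksign (sdeg G a + wdeg G (take i ys) * wdeg G (drop i ys) + sdeg G b * wdeg G (take k1 (rotate i ys)))
        * ginv pr E a b * \<phi> (a # take k1 (rotate i ys)) * \<phi> (b # drop k1 (rotate i ys))) = 0"
      unfolding t_def .
  qed
qed

end

section \<open>Words modulo multilinearity\<close>

lemma lookup_scaleR: "Poly_Mapping.lookup (r *\<^sub>R t) k = r * Poly_Mapping.lookup t k"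
  for t :: "'k \<Rightarrow>\<^sub>0 real"
proof -
  have "finite {i. r *\<^sub>R Poly_Mapping.lookup t i \<noteq> 0}"
    by (rule finite_subset[OF _ finite_keys[of t]]) (auto simp: in_keys_iff)
  then show ?thesis by (simp add: scaleR_poly_mapping_def Abs_poly_mapping_inverse)
qed

lemma tlin_superset:
  assumes "finite S" "Poly_Mapping.keys t \<subseteq> S"
  shows "tlin f t = (\<Sum>cs\<in>S. Poly_Mapping.lookup t cs *\<^sub>R f cs)"
  unfolding tlin_def using assms by (intro sum.mono_neutral_left) (auto simp: in_keys_iff)

lemma linear_tlin:
  fixes f :: "'c list \<Rightarrow> 'w::real_vector"
  shows "linear (tlin f)"
proof (rule linearI)
  fix s t :: "'c list \<Rightarrow>\<^sub>0 real" and r :: real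
  let ?S = "Poly_Mapping.keys s \<union> Poly_Mapping.keys t"
  show "tlin f (s + t) = tlin f s + tlin f t"
    using Poly_Mapping.keys_add[of s t]
    by (simp add: tlin_superset[of ?S] lookup_add scaleR_add_left sum.distrib)
  show "tlin f (r *\<^sub>R t) = r *\<^sub>R tlin f t"
    by (subst tlin_superset[of "Poly_Mapping.keys t"])
      (auto simp: in_keys_iff lookup_scaleR tlin_def scaleR_sum_right)
qed

lemma tlin_tw [simp]: "tlin f (tw cs) = f cs"
  by (simp add: tlin_def)

lemma tlin_scaleR_tw [simp]: "tlin f (c *\<^sub>R tw cs) = c *\<^sub>R f cs"
  using linear_scale[OF linear_tlin, of f c "tw cs"] by simp

lemma tlin_0 [simp]: "tlin f 0 = 0"
  by (simp add: tlin_def)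

lemma linear_tmul: "linear (\<lambda>s. tmul s t)"
  unfolding tmul_def by (rule linear_tlin)

lemma tmul_simps [simp]: "tmul (tw us) (tw vs) = tw (us @ vs)" "tmul 0 t = 0" "tmul s 0 = 0"
  by (simp_all add: tmul_def) (simp add: tlin_def)

text \<open>The relations among \<open>sym_rels\<close> that define the tensor product. Unlike signed permutations, they
are stable under appending letters without any bookkeeping of signs.\<close>

definition multilinear_rels :: "(int \<Rightarrow> 'c::real_vector set) \<Rightarrow> nat \<Rightarrow> ('c list \<Rightarrow>\<^sub>0 real) set"
  where "multilinear_rels V k =
    {tw (us @ (a *\<^sub>R x + b *\<^sub>R y) # vs) - a *\<^sub>R tw (us @ x # vs) - b *\<^sub>R tw (us @ y # vs)
       | us vs a b x y j. x \<in> V j \<and> y \<in> V j \<and> us @ x # vs \<in> words V k}"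

lemma multilinear_rels_subset: "span (multilinear_rels V k) \<subseteq> span (sym_rels V k)"
  unfolding multilinear_rels_def sym_rels_def by (rule span_mono) blast

lemma multilinear_relI:
  assumes "x \<in> V j" "y \<in> V j" "set us \<subseteq> homog V" "set vs \<subseteq> homog V" "length us + length vs + 1 = k"
  shows "tw (us @ (a *\<^sub>R x + b *\<^sub>R y) # vs) - a *\<^sub>R tw (us @ x # vs) - b *\<^sub>R tw (us @ y # vs)
     \<in> span (multilinear_rels V k)"
proof -
  have "us @ x # vs \<in> words V k" using assms by (auto simp: words_def homog_def)
  then show ?thesis
    using assms(1,2) unfolding multilinear_rels_def by (intro span_base CollectI) blast
qed

lemma zero_word_in_rels:
  assumes "0 \<in> V j" "set us \<subseteq> homog V" "set vs \<subseteq> homog V" "length us + length vs + 1 = k"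
  shows "tw (us @ 0 # vs) \<in> span (multilinear_rels V k)"
  using multilinear_relI[where V = V and j = j, OF assms(1,1) assms(2-4), of 0 0] by simp

lemma tmul_multilinear_rels:
  assumes r: "r \<in> span (multilinear_rels V k)" and w: "set w \<subseteq> homog V"
  shows "tmul r (tw w) \<in> span (multilinear_rels V (k + length w))"
  using r
proof (induction rule: span_induct)
  case base
  show ?case
    by (rule subspaceI) (simp_all add: linear_add[OF linear_tmul] linear_scale[OF linear_tmul] span_0 span_add span_scale)
next
  case (step r)
  then obtain us vs a b x y j where r: "r = tw (us @ (a *\<^sub>R x + b *\<^sub>R y) # vs) - a *\<^sub>R tw (us @ x # vs) - b *\<^sub>R tw (us @ y # vs)"
    and xy: "x \<in> V j" "y \<in> V j" and wd: "us @ x # vs \<in> words V k"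
    unfolding multilinear_rels_def by blast
  have "tmul r (tw w) = tw (us @ (a *\<^sub>R x + b *\<^sub>R y) # (vs @ w)) - a *\<^sub>R tw (us @ x # (vs @ w)) - b *\<^sub>R tw (us @ y # (vs @ w))"
    unfolding r by (simp add: linear_diff[OF linear_tmul] linear_scale[OF linear_tmul])
  then show ?case
    using multilinear_relI[where V = V and j = j, OF xy, of us "vs @ w"] wd w by (simp add: words_def)
qed

lemma tw_pair_sum_right:
  assumes sub: "subspace (V j)" and v: "v \<in> V i"
    and fin: "finite I" and w: "\<And>k. k \<in> I \<Longrightarrow> c k \<noteq> 0 \<Longrightarrow> w k \<in> V j"
  shows "tw [v, \<Sum>k\<in>I. c k *\<^sub>R w k] - (\<Sum>k\<in>I. c k *\<^sub>R tw [v, w k]) \<in> span (multilinear_rels V 2)"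
  using fin w
proof (induction rule: finite_induct)
  case empty
  show ?case
    using zero_word_in_rels[of V j "[v]" "[]" 2] subspace_0[OF sub] v by (auto simp: homog_def)
next
  case (insert k I)
  let ?S = "\<Sum>k\<in>I. c k *\<^sub>R w k"
  show ?case
  proof (cases "c k = 0")
    case True
    then show ?thesis using insert by simp
  next
    case False
    have "?S \<in> V j"
    proof (rule subspace_sum[OF sub])
      show "c l *\<^sub>R w l \<in> V j" if "l \<in> I" for l
        using insert.prems[of l] that subspace_scale[OF sub] subspace_0[OF sub] by (cases "c l = 0") auto
    qed
    then have "tw ([v] @ (c k *\<^sub>R w k + 1 *\<^sub>R ?S) # []) - c k *\<^sub>R tw ([v] @ w k # []) - 1 *\<^sub>R tw ([v] @ ?S # [])
        \<in> span (multilinear_rels V 2)"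
      using insert.prems[of k] False v by (intro multilinear_relI) (auto simp: homog_def)
    from span_add[OF this insert.IH] show ?thesis
      using insert by (simp add: algebra_simps)
  qed
qed

text \<open>One summand of \<open>\<Sum>\<^sub>k v\<^sub>k \<otimes> w\<^sub>k\<close> is eliminated at a time, as in Gaussian elimination: if
\<open>g(v\<^sub>k) \<noteq> 0\<close>, then applying \<open>g\<close> to the first factors expresses \<open>w\<^sub>k\<close> as a combination \<open>\<Sum> c\<^sub>l w\<^sub>l\<close>, and
\<open>v\<^sub>k \<otimes> w\<^sub>k\<close> is absorbed by replacing \<open>v\<^sub>l\<close> with \<open>v\<^sub>l + c\<^sub>l v\<^sub>k\<close>. Words may only have homogeneous
letters, so the degrees \<open>p\<close> and \<open>q\<close> of the factors are tracked.\<close>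

lemma tensor_zero_finite_sum:
  fixes V :: "int \<Rightarrow> 'c::real_vector set" and H :: "('c \<Rightarrow> real) set"
  assumes sub: "\<And>j. subspace (V j)" and lin: "\<And>h. h \<in> H \<Longrightarrow> linear h"
    and deg: "\<And>h. h \<in> H \<Longrightarrow> \<exists>D. \<forall>j v. v \<in> V j \<longrightarrow> j \<noteq> D \<longrightarrow> h v = 0"
    and sep: "\<And>j v. v \<in> V j \<Longrightarrow> (\<And>h. h \<in> H \<Longrightarrow> h v = 0) \<Longrightarrow> v = 0"
    and "finite I" and "\<And>k. k \<in> I \<Longrightarrow> v k \<in> V (p k)" and "\<And>k. k \<in> I \<Longrightarrow> w k \<in> V (q k)"
    and "\<And>g h. g \<in> H \<Longrightarrow> h \<in> H \<Longrightarrow> (\<Sum>k\<in>I. g (v k) * h (w k)) = 0"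
  shows "(\<Sum>k\<in>I. tw [v k, w k]) \<in> span (multilinear_rels V 2)"
  using assms(5-8)
proof (induction I arbitrary: v rule: finite_induct)
  case empty
  show ?case by (simp add: span_0)
next
  case (insert k I v)
  have homog: "x \<in> homog V" if "x \<in> V j" for x j using that by (auto simp: homog_def)
  have vk: "v k \<in> V (p k)" and wk: "w k \<in> V (q k)" using insert.prems by auto
  show ?case
  proof (cases "v k = 0")
    case True
    have "(\<Sum>k\<in>I. tw [v k, w k]) \<in> span (multilinear_rels V 2)"
    proof (rule insert.IH)
      fix g h assume "g \<in> H" "h \<in> H"
      then show "(\<Sum>k\<in>I. g (v k) * h (w k)) = 0"
        using insert.prems(3)[of g h] insert.hyps True linear_0[OF lin[of g]] by simp
    qed (use insert.prems in auto)
    moreover have "tw [v k, w k] \<in> span (multilinear_rels V 2)"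
      using zero_word_in_rels[of V "p k" "[]" "[w k]" 2] vk homog[OF wk] True by simp
    ultimately show ?thesis using insert.hyps by (simp add: span_add)
  next
    case False
    then obtain g where g: "g \<in> H" "g (v k) \<noteq> 0" using sep[OF vk] by blast
    have g_deg: "g u = 0" if "u \<in> V j" "j \<noteq> p k" for u j
      using deg[OF g(1)] vk g(2) that by blast
    \<comment> \<open>The combination may be restricted to summands with the degrees of the eliminated one: all others are killed by \<open>g\<close> or by the functionals that detect \<open>w k\<close>. This keeps the new first factors homogeneous.\<close>
    define c where "c l = (if p l = p k \<and> q l = q k then - g (v l) / g (v k) else 0)" for l
    have c: "p l = p k \<and> q l = q k" if "c l \<noteq> 0" for l
      using that by (simp add: c_def split: if_splits)
    have w_eq_h: "h (w k) = (\<Sum>l\<in>I. c l * h (w l))" if h: "h \<in> H" for h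
    proof (cases "h (w k) = 0 \<and> (\<forall>l\<in>I. c l \<noteq> 0 \<longrightarrow> h (w l) = 0)")
      case True
      then have "(\<Sum>l\<in>I. c l * h (w l)) = 0" by (intro sum.neutral) auto
      then show ?thesis using True by simp
    next
      case False
      then consider "h (w k) \<noteq> 0" | l where "l \<in> I" "c l \<noteq> 0" "h (w l) \<noteq> 0" by blast
      then obtain u where "u \<in> V (q k)" "h u \<noteq> 0"
      proof cases
        case 1
        then show ?thesis using that wk by blast
      next
        case (2 l)
        then show ?thesis using that[of "w l"] insert.prems(2)[of l] c[of l] by simp
      qed
      then have h_deg: "h x = 0" if "x \<in> V j" "j \<noteq> q k" for x j
        using deg[OF h] that by blast
      have "g (v l) * h (w l) = - g (v k) * (c l * h (w l))" if "l \<in> I" for l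
      proof (cases "p l = p k \<and> q l = q k")
        case True
        then show ?thesis using g by (simp add: c_def)
      next
        case False
        then have "g (v l) = 0 \<or> h (w l) = 0"
          using g_deg h_deg insert.prems(1,2) that by blast
        then show ?thesis using False by (auto simp: c_def)
      qed
      then have "(\<Sum>l\<in>I. g (v l) * h (w l)) = - g (v k) * (\<Sum>l\<in>I. c l * h (w l))"
        by (simp add: sum_distrib_left)
      then have "g (v k) * (h (w k) - (\<Sum>l\<in>I. c l * h (w l))) = 0"
        using insert.prems(3)[OF g(1) h] insert.hyps by (simp add: algebra_simps)
      then show ?thesis using g by simp
    qed
    have cw: "c l *\<^sub>R w l \<in> V (q k)" if "l \<in> I" for l
      using c[of l] insert.prems(2)[of l] that subspace_scale[OF sub] subspace_0[OF sub]
      by (cases "c l = 0") auto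
    have w_eq: "w k = (\<Sum>l\<in>I. c l *\<^sub>R w l)"
    proof -
      have "w k - (\<Sum>l\<in>I. c l *\<^sub>R w l) = 0"
      proof (rule sep)
        show "w k - (\<Sum>l\<in>I. c l *\<^sub>R w l) \<in> V (q k)"
          by (intro subspace_diff subspace_sum sub wk cw)
        show "h (w k - (\<Sum>l\<in>I. c l *\<^sub>R w l)) = 0" if "h \<in> H" for h
          using w_eq_h[OF that] by (simp add: linear_diff linear_sum linear_scale lin[OF that])
      qed
      then show ?thesis by simp
    qed
    have s1: "(\<Sum>l\<in>I. tw [v l + c l *\<^sub>R v k, w l]) \<in> span (multilinear_rels V 2)"
    proof (rule insert.IH)
      show "v l + c l *\<^sub>R v k \<in> V (p l)" if "l \<in> I" for l
        using c[of l] insert.prems(1)[of l] that vk subspace_add[OF sub] subspace_scale[OF sub]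
        by (cases "c l = 0") auto
      fix g h assume gh: "g \<in> H" "h \<in> H"
      have "(\<Sum>l\<in>I. g (v l + c l *\<^sub>R v k) * h (w l))
          = (\<Sum>l\<in>I. g (v l) * h (w l)) + g (v k) * (\<Sum>l\<in>I. c l * h (w l))"
        by (simp add: linear_add linear_scale lin[OF gh(1)] sum.distrib sum_distrib_left algebra_simps)
      then show "(\<Sum>l\<in>I. g (v l + c l *\<^sub>R v k) * h (w l)) = 0"
        using insert.prems(3)[OF gh] insert.hyps w_eq_h[OF gh(2)] by simp
    qed (use insert.prems in auto)
    have s2: "(\<Sum>l\<in>I. tw [v l + c l *\<^sub>R v k, w l] - tw [v l, w l] - c l *\<^sub>R tw [v k, w l])
        \<in> span (multilinear_rels V 2)"
    proof (rule span_sum)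
      fix l assume l: "l \<in> I"
      show "tw [v l + c l *\<^sub>R v k, w l] - tw [v l, w l] - c l *\<^sub>R tw [v k, w l]
          \<in> span (multilinear_rels V 2)"
      proof (cases "c l = 0")
        case True
        then show ?thesis by (simp add: span_0)
      next
        case False
        have vl: "v l \<in> V (p k)" using insert.prems(1)[of l] l c[OF False] by simp
        have "w l \<in> homog V" using insert.prems(2)[of l] l homog by blast
        then show ?thesis
          using multilinear_relI[of "v l" V "p k" "v k" "[]" "[w l]" 2 1 "c l", OF vl vk] by simp
      qed
    qed
    have s3: "tw [v k, w k] - (\<Sum>l\<in>I. c l *\<^sub>R tw [v k, w l]) \<in> span (multilinear_rels V 2)"
      using tw_pair_sum_right[where V = V and j = "q k", OF sub vk insert.hyps(1), of c w] c insert.prems(2)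
      by (fastforce simp flip: w_eq)
    from span_add[OF span_diff[OF s1 s2] s3] show ?thesis
      using insert.hyps by (simp add: sum_subtractf sum.distrib algebra_simps)
  qed
qed

lemma tensor_zero:
  fixes V :: "int \<Rightarrow> 'c::real_vector set" and H :: "('c \<Rightarrow> real) set"
  assumes sub: "\<And>j. subspace (V j)" and lin: "\<And>h. h \<in> H \<Longrightarrow> linear h"
    and deg: "\<And>h. h \<in> H \<Longrightarrow> \<exists>D. \<forall>j v. v \<in> V j \<longrightarrow> j \<noteq> D \<longrightarrow> h v = 0"
    and sep: "\<And>j v. v \<in> V j \<Longrightarrow> (\<And>h. h \<in> H \<Longrightarrow> h v = 0) \<Longrightarrow> v = 0"
    and t: "t \<in> span (tw ` words V 2)"
    and zero: "\<And>g h. g \<in> H \<Longrightarrow> h \<in> H \<Longrightarrow> tlin (\<lambda>cs. g (cs ! 0) * h (cs ! 1)) t = 0"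
  shows "t \<in> span (multilinear_rels V 2)"
proof -
  let ?K = "Poly_Mapping.keys t" and ?c = "Poly_Mapping.lookup t"
  have "?K \<subseteq> words V 2"
    using t
  proof (induction rule: span_induct)
    case base
    show ?case
    proof (rule subspaceI)
      show "x + y \<in> {t. Poly_Mapping.keys t \<subseteq> words V 2}"
        if "x \<in> {t. Poly_Mapping.keys t \<subseteq> words V 2}" "y \<in> {t. Poly_Mapping.keys t \<subseteq> words V 2}" for x y
        using that Poly_Mapping.keys_add[of x y] by auto
    qed (auto simp: in_keys_iff lookup_scaleR subset_iff)
  next
    case (step x)
    then show ?case by auto
  qed
  then have "cs \<in> words V 2" if "cs \<in> ?K" for cs
    using that by blast
  then have K: "cs = [cs ! 0, cs ! 1] \<and> cs ! 0 \<in> homog V \<and> cs ! 1 \<in> homog V" if "cs \<in> ?K" for cs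
    using that by (fastforce simp: words_def numeral_2_eq_2 length_Suc_conv)
  define p where "p cs = (SOME j. cs ! 0 \<in> V j)" for cs
  define q where "q cs = (SOME j. cs ! 1 \<in> V j)" for cs
  have p: "cs ! 0 \<in> V (p cs)" and q: "cs ! 1 \<in> V (q cs)" if "cs \<in> ?K" for cs
    using K[OF that] unfolding p_def q_def homog_def by (auto intro: someI)
  have s1: "(\<Sum>cs\<in>?K. tw [?c cs *\<^sub>R cs ! 0, cs ! 1]) \<in> span (multilinear_rels V 2)"
  proof (rule tensor_zero_finite_sum[where V = V and H = H and p = p and q = q])
    show "?c cs *\<^sub>R cs ! 0 \<in> V (p cs)" if "cs \<in> ?K" for cs
      using subspace_scale[OF sub p[OF that]] .
    show "(\<Sum>cs\<in>?K. g (?c cs *\<^sub>R cs ! 0) * h (cs ! 1)) = 0" if "g \<in> H" "h \<in> H" for g h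
      using zero[OF that] by (simp add: tlin_def linear_scale[OF lin[OF that(1)]] mult.assoc)
  qed (use sub lin deg sep q in auto)
  have s2: "(\<Sum>cs\<in>?K. tw [?c cs *\<^sub>R cs ! 0, cs ! 1] - ?c cs *\<^sub>R tw cs) \<in> span (multilinear_rels V 2)"
  proof (rule span_sum)
    fix cs assume cs: "cs \<in> ?K"
    have "tw ([] @ (?c cs *\<^sub>R cs ! 0 + 0 *\<^sub>R cs ! 0) # [cs ! 1]) - ?c cs *\<^sub>R tw ([] @ cs ! 0 # [cs ! 1])
        - 0 *\<^sub>R tw ([] @ cs ! 0 # [cs ! 1]) \<in> span (multilinear_rels V 2)"
      using K[OF cs] p[OF cs] by (intro multilinear_relI) auto
    then show "tw [?c cs *\<^sub>R cs ! 0, cs ! 1] - ?c cs *\<^sub>R tw cs \<in> span (multilinear_rels V 2)"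
      using K[OF cs] by simp
  qed
  have "(\<Sum>cs\<in>?K. ?c cs *\<^sub>R tw cs) = t"
    by (rule poly_mapping_eqI)
      (simp add: lookup_sum lookup_scaleR lookup_single when_def in_keys_iff sum.delta' if_distrib cong: if_cong)
  with span_diff[OF s1 s2] show ?thesis by (simp add: sum_subtractf)
qed

section \<open>Powers of one element in the symmetric algebra\<close>

text \<open>All permutations fix a power, so every summand of the extended operation is a multiple of one and
the same product, the Koszul signs entering as scalar factors only.\<close>

lemma op_ext_replicate:
  assumes "k \<le> N \<Longrightarrow> tmul (p (replicate k \<phi>)) (tw (replicate (N - k) \<phi>)) \<in> span R"
  shows "op_ext V k p (c *\<^sub>R tw (replicate N \<phi>)) \<in> span R"
proof (cases "k \<le> N")
  case True
  have "permute_list \<rho> (replicate N \<phi>) = replicate N \<phi>" if "\<rho> permutes {..<N}" for \<rho>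
    using that by (intro replicate_eqI) (auto dest: set_permute_list[of \<rho> "replicate N \<phi>", THEN equalityD1, THEN subsetD])
  then show ?thesis
    using True assms by (auto simp: op_ext_def intro!: span_scale span_sum)
qed (simp add: op_ext_def span_0)

text \<open>A product of components is nonzero only if all its factors have index \<open>(1,0)\<close>, and then word length
\<open>q\<close> forces \<open>q\<close> factors.\<close>

lemma exp_coeff_line:
  "exp_coeff (\<lambda>l g. if (l, g) = (1, 0) then (\<lambda>i. tw [\<phi>]) else (\<lambda>i. 0)) j q i \<in> span {tw (replicate q \<phi>)}"
    (is "exp_coeff ?m j q i \<in> _")
proof -
  have prod: "foldr tmul (map (\<lambda>(l, g). ?m l g i) ps) (tw [])
      = (if \<forall>p\<in>set ps. p = (1, 0) then tw (replicate (length ps) \<phi>) else 0)" for ps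
    by (induction ps) (auto split: if_splits)
  have len: "(\<Sum>(l, g)\<leftarrow>ps. l) = length ps" if "\<forall>p\<in>set ps. p = (1, 0::nat)" for ps
    using that by (induction ps) auto
  show ?thesis
    unfolding exp_coeff_def
  proof (intro span_sum span_scale)
    fix ps assume "ps \<in> {ps. (\<forall>(l, g)\<in>set ps. l \<ge> 1) \<and> (\<Sum>(l, g)\<leftarrow>ps. l) = q
      \<and> (\<Sum>(l, g)\<leftarrow>ps. int g - 1) = j}"
    then show "foldr tmul (map (\<lambda>(l, g). ?m l g i) ps) (tw []) \<in> span {tw (replicate q \<phi>)}"
      unfolding prod using len[of ps] by (auto intro: span_base span_0)
  qed
qed

section \<open>Evaluation of cyclic cochains\<close>

lemma scaleR_fun_apply: "(r *\<^sub>R f) x = r *\<^sub>R f x"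
  by (simp add: scaleR_fun_def)

lemma subspace_Bcyc_deg: "subspace (Bcyc_deg G D)"
  unfolding Bcyc_deg_def Bcyc_all_def
  by (rule subspaceI) (auto simp: span_0 span_add span_scale scaleR_fun_apply)

lemma linear_fun_apply: "linear (\<lambda>\<phi>. \<phi> xs)"
  by (rule linearI) (simp_all add: scaleR_fun_apply)

lemma Bcyc_all_multilinear:
  assumes "\<phi> \<in> Bcyc_all G"
  shows "linear (\<lambda>x. \<phi> (us @ x # vs))"
  using assms unfolding Bcyc_all_def
proof (induction rule: span_induct)
  case base
  show ?case
    by (rule subspaceI)
      (auto simp: scaleR_fun_apply linear_compose_add module_hom_zero
        simp del: real_scaleR_def intro: linear_compose_scale_right)
next
  case (step \<phi>)
  then obtain k where \<phi>: "\<phi> \<in> Bcyc G k" by blast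
  show ?case
  proof (cases "length us + length vs + 1 = k")
    case True
    then show ?thesis using \<phi> by (simp add: Bcyc_def multilinear_def)
  next
    case False
    then have "(\<lambda>x. \<phi> (us @ x # vs)) = (\<lambda>x. 0)" using \<phi> by (auto simp: Bcyc_def)
    then show ?thesis by (simp add: module_hom_zero)
  qed
qed

lemma Bcyc_all_eq_0:
  assumes gr: "grading G" and \<phi>: "\<phi> \<in> Bcyc_all G"
    and zero: "\<And>xs. set xs \<subseteq> homog G \<Longrightarrow> \<phi> xs = 0"
  shows "\<phi> = 0"
proof -
  have "\<phi> (us @ vs) = 0" if "set us \<subseteq> homog G" for us vs
    using that
  proof (induction vs arbitrary: us)
    case Nil
    then show ?case using zero by simp
  next
    case (Cons x vs)
    have dec: "is_decomposition G x (hcomp G x)" using hcomp_decomposition[OF gr] .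
    then have "\<phi> (us @ x # vs) = \<phi> (us @ (\<Sum>j | hcomp G x j \<noteq> 0. hcomp G x j) # vs)"
      by (simp add: is_decomposition_def)
    also have "\<dots> = (\<Sum>j | hcomp G x j \<noteq> 0. \<phi> ((us @ [hcomp G x j]) @ vs))"
      using linear_sum[OF Bcyc_all_multilinear[OF \<phi>]] by simp
    also have "\<dots> = 0"
      using dec Cons.prems by (intro sum.neutral ballI Cons.IH) (auto simp: is_decomposition_def homog_def)
    finally show ?case .
  qed
  from this[of "[]"] show ?thesis by (simp add: fun_eq_iff)
qed

text \<open>Evaluations at homogeneous words are functionals to which \<open>tensor_zero\<close> applies: each of them sees
only cochains of one degree, and together they separate cochains by multilinearity.\<close>

lemma teval_zero:
  assumes gr: "grading G" and t: "t \<in> span (tw ` words (shift s (Bcyc_deg G)) 2)"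
    and zero: "\<And>xs ys. set xs \<subseteq> homog G \<Longrightarrow> set ys \<subseteq> homog G \<Longrightarrow> teval t xs ys = 0"
  shows "t \<in> span (multilinear_rels (shift s (Bcyc_deg G)) 2)"
proof (rule tensor_zero[where H = "{\<lambda>\<phi>. \<phi> xs | xs. set xs \<subseteq> homog G}"])
  show "subspace (shift s (Bcyc_deg G) j)" for j
    by (simp add: shift_def subspace_Bcyc_deg)
  fix h assume "h \<in> {\<lambda>\<phi>::'a list \<Rightarrow> real. \<phi> xs | xs. set xs \<subseteq> homog G}"
  then obtain xs where h: "h = (\<lambda>\<phi>. \<phi> xs)" "set xs \<subseteq> homog G" by blast
  show "linear h" unfolding h by (rule linear_fun_apply)
  show "\<exists>D. \<forall>j v. v \<in> shift s (Bcyc_deg G) j \<longrightarrow> j \<noteq> D \<longrightarrow> h v = 0"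
    by (rule exI[of _ "wdeg G xs - s"]) (use h in \<open>auto simp: shift_def Bcyc_deg_def\<close>)
next
  fix j \<phi> assume "\<phi> \<in> shift s (Bcyc_deg G) j"
    and "\<And>h. h \<in> {\<lambda>\<phi>. \<phi> xs | xs. set xs \<subseteq> homog G} \<Longrightarrow> h \<phi> = 0"
  then show "\<phi> = 0"
    by (intro Bcyc_all_eq_0[OF gr]) (auto simp: shift_def Bcyc_deg_def)
next
  fix g h assume "g \<in> {\<lambda>\<phi>::'a list \<Rightarrow> real. \<phi> xs | xs. set xs \<subseteq> homog G}"
    "h \<in> {\<lambda>\<phi>::'a list \<Rightarrow> real. \<phi> xs | xs. set xs \<subseteq> homog G}"
  then show "tlin (\<lambda>cs. g (cs ! 0) * h (cs ! 1)) t = 0"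
    using zero by (auto simp: teval_def)
qed (rule t)

section \<open>The Maurer-Cartan equation\<close>

context cyclic_dga
begin

lemma delta_m2_plus: "bar_delta G pr E \<phi> xs ys = 0"
proof (cases "xs = [] \<or> ys = []")
  case False
  then have "length xs \<ge> 1" "length ys \<ge> 1" by (simp_all add: Suc_le_eq)
  then have "\<phi> (a # rotate i xs @ b # rotate i' ys) = 0" for a b i i'
    by (intro m2_plus_other) simp
  then show ?thesis by (simp add: bar_delta_def)
qed (auto simp: bar_delta_def)

abbreviation V where "V \<equiv> shift 1 (bar_C n G)"

lemma V_eq: "V = shift (3 - int n) (Bcyc_deg G)"
  by (simp add: bar_C_def shift_def add.assoc)

lemma zero_in_V: "0 \<in> V j"
  unfolding V_eq by (simp add: shift_def subspace_0[OF subspace_Bcyc_deg])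

lemma m2_plus_V: "\<phi> \<in> V (2 * (int n - 3))"
  unfolding V_eq using m2_plus_degree by (simp add: shift_def)

text \<open>The cobracket vanishes, so \<open>0\<close> is an admissible choice in the definition of \<open>bar_p120\<close>, and whatever
is chosen evaluates to zero.\<close>

lemma p120_m2_plus: "bar_p120 n G pr E \<phi> \<in> span (multilinear_rels V 2)"
proof -
  let ?P = "\<lambda>t. t \<in> span (tw ` words V 2) \<and>
    (\<forall>xs ys. set xs \<subseteq> homog G \<longrightarrow> set ys \<subseteq> homog G \<longrightarrow>
       teval t xs ys = 1 / 2 * ksign ((int n - 3) * wdeg G xs) * bar_delta G pr E \<phi> xs ys)"
  have "?P 0" by (simp add: span_0 teval_def delta_m2_plus)
  then have "?P (bar_p120 n G pr E \<phi>)"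
    unfolding bar_p120_def by (rule someI)
  then show ?thesis
    unfolding V_eq by (intro teval_zero[OF grading]) (simp_all add: delta_m2_plus)
qed

end

context cyclic_dga_basis
begin

text \<open>The power \<open>\<phi>\<^bsup>q+k-l\<^esup>\<close> is the one that an operation with \<open>k\<close> inputs and \<open>l\<close> outputs sends to words of
length \<open>q\<close>. A vanishing cochain among the letters makes a word zero by multilinearity.\<close>

lemma bar_ops_m2_plus:
  assumes "1 \<le> k" "1 \<le> l" "l \<le> q" "k \<le> q + k - l"
  shows "tmul (bar_ops n G pr d E k l g (replicate k \<phi>)) (tw (replicate (q + k - l - k) \<phi>))
    \<in> span (sym_rels V q)"
proof -
  have hom: "set (replicate r \<phi>) \<subseteq> homog V" for r
    using m2_plus_V by (auto simp: homog_def)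
  have zero: "tw (0 # replicate (q - 1) \<phi>) \<in> span (multilinear_rels V q)" if "q \<ge> 1"
    using zero_word_in_rels[where V = V and j = 0 and us = "[]" and vs = "replicate (q - 1) \<phi>" and k = q]
      zero_in_V hom that by simp
  have p210: "bar_p210 n G pr E \<phi> \<phi> = 0"
    by (simp add: bar_p210_def mu_m2_plus)
  consider "(k, l, g) = (1, 1, 0)" | "(k, l, g) = (2, 1, 0)" | "(k, l, g) = (1, 2, 0)"
    | "(k, l, g) \<noteq> (1, 1, 0)" "(k, l, g) \<noteq> (2, 1, 0)" "(k, l, g) \<noteq> (1, 2, 0)" by blast
  then have "tmul (bar_ops n G pr d E k l g (replicate k \<phi>)) (tw (replicate (q + k - l - k) \<phi>))
    \<in> span (multilinear_rels V q)"
  proof cases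
    case 1
    then show ?thesis using zero assms by (simp add: bar_ops_def p110_m2_plus)
  next
    case 2
    moreover have "replicate 2 \<phi> = [\<phi>, \<phi>]" by (simp add: numeral_2_eq_2)
    ultimately show ?thesis using zero assms by (simp add: bar_ops_def p210)
  next
    case 3
    then have "2 + (q - 2) = q" "q + k - l - k = q - 2" using assms by simp_all
    with 3 show ?thesis
      using tmul_multilinear_rels[OF p120_m2_plus[of E] hom[of "q - 2"]]
      by (auto simp: bar_ops_def)
  next
    case 4
    then show ?thesis by (auto simp: bar_ops_def span_0)
  qed
  then show ?thesis using multilinear_rels_subset by blast
qed

lemma mc_partial_m2_plus:
  "mc_partial V (bar_ops n G pr d E)
     (\<lambda>l g. if (l, g) = (1, 0) then (\<lambda>i. tw [\<phi>]) else (\<lambda>i. 0)) j q N i \<in> span (sym_rels V q)"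
  unfolding mc_partial_def
proof (intro span_sum)
  fix k l g assume kl: "k \<in> {1..N}" "l \<in> {1..q}"
  obtain c where c: "exp_coeff (\<lambda>l g. if (l, g) = (1, 0) then (\<lambda>i. tw [\<phi>]) else (\<lambda>i. 0))
      (j - (int k + int g - 1)) (q + k - l) i = c *\<^sub>R tw (replicate (q + k - l) \<phi>)"
    using exp_coeff_line[of \<phi> "j - (int k + int g - 1)" "q + k - l" i] by (auto simp: span_singleton)
  show "op_ext V k (bar_ops n G pr d E k l g)
      (exp_coeff (\<lambda>l g. if (l, g) = (1, 0) then (\<lambda>i. tw [\<phi>]) else (\<lambda>i. 0))
        (j - (int k + int g - 1)) (q + k - l) i) \<in> span (sym_rels V q)"
    unfolding c using kl by (intro op_ext_replicate bar_ops_m2_plus) auto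
qed

lemma maurer_cartan_m2_plus:
  "maurer_cartan (bar_C n G) (Bcyc_filt G) (int n - 3) 2 (bar_ops n G pr d E)
     (\<lambda>l g. if (l, g) = (1, 0) then (\<lambda>i. tw [\<phi>]) else (\<lambda>i. 0))"
proof -
  let ?F = "Bcyc_filt G"
  have rels: "span (sym_rels V q) \<subseteq> sym_filt V ?F q lam" for q lam
    unfolding sym_filt_def by (rule span_mono) blast
  have zero: "0 \<in> sym_filt V ?F q lam" for q lam
    unfolding sym_filt_def by (rule span_0)
  have word: "[\<phi>] \<in> words V 1"
    using m2_plus_V by (auto simp: words_def homog_def)
  have filt: "tw [\<phi>] \<in> sym_filt V ?F 1 3"
  proof -
    \<comment> \<open>Filtration degree 3 exceeds the required bound \<open>2 \<cdot> \<chi> = 2\<close> strictly.\<close>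
    have "\<phi> \<in> ?F 3"
      unfolding Bcyc_filt_def using m2_plus_Bcyc by (intro span_base UN_I[of 3]) auto
    then have "list_all2 (\<lambda>c l. c \<in> ?F l) [\<phi>] [3]" "3 \<le> sum_list [3::real]" by simp_all
    then show ?thesis unfolding sym_filt_def using word by (intro span_base UnI2) blast
  qed
  have filt2: "tw [\<phi>] \<in> sym_filt V ?F 1 2"
    using filt unfolding sym_filt_def
    by (rule subsetD[OF span_mono, rotated]) force
  have deg: "tw [\<phi>] \<in> span (sym_filt V ?F 1 lam \<union>
    {tw cs | cs ds. length cs = 1 \<and> list_all2 (\<lambda>c j. c \<in> V j) cs ds \<and> sum_list ds = 2 * (int n - 3)})" for lam
  proof -
    have "list_all2 (\<lambda>c j. c \<in> V j) [\<phi>] [2 * (int n - 3)]" using m2_plus_V by simp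
    then show ?thesis by (intro span_base UnI2) force
  qed
  have mc: "mc_partial V (bar_ops n G pr d E)
     (\<lambda>l g. if (l, g) = (1, 0) then (\<lambda>i. tw [\<phi>]) else (\<lambda>i. 0)) j q N i \<in> sym_filt V ?F q lam" for j q N i lam
    using rels mc_partial_m2_plus by blast
  have word_span: "tw [\<phi>] \<in> span (tw ` words V 1)" using word by (intro span_base) blast
  show ?thesis
    unfolding maurer_cartan_def Let_def
  proof (intro conjI allI impI)
    fix l g :: nat
    assume "1 \<le> l"
    show "(if (l, g) = (1, 0) then (\<lambda>i. tw [\<phi>]) else (\<lambda>i. 0)) \<in> Ehat V ?F l"
      using word_span by (auto simp: Ehat_def zero span_0)
    show "Ehat_degree V ?F l (- 2 * (int n - 3) * (int g - 1))
        (if (l, g) = (1, 0) then (\<lambda>i. tw [\<phi>]) else (\<lambda>i. 0))"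
      using deg by (auto simp: Ehat_degree_def span_0)
    show "norm_ge V ?F l (2 * real_of_int (euler_char 0 l g))
        (if (l, g) = (1, 0) then (\<lambda>i. tw [\<phi>]) else (\<lambda>i. 0))"
      using filt2 by (auto simp: norm_ge_def euler_char_def zero)
  next
    show "norm_gt V ?F 1 (2 * real_of_int (euler_char 0 1 0))
        (if (1::nat, 0::nat) = (1, 0) then (\<lambda>i. tw [\<phi>]) else (\<lambda>i. 0))"
      unfolding norm_gt_def by (rule exI[of _ 3]) (use filt in \<open>simp add: norm_ge_def euler_char_def\<close>)
    show "norm_gt V ?F 2 (2 * real_of_int (euler_char 0 2 0))
        (if (2::nat, 0::nat) = (1, 0) then (\<lambda>i. tw [\<phi>]) else (\<lambda>i. 0))"
      unfolding norm_gt_def by (rule exI[of _ 1]) (simp add: norm_ge_def euler_char_def zero)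
  next
    fix j q lam
    show "\<forall>\<^sub>F N in sequentially. norm_ge V ?F q lam (mc_partial V (bar_ops n G pr d E)
     (\<lambda>l g. if (l, g) = (1, 0) then (\<lambda>i. tw [\<phi>]) else (\<lambda>i. 0)) j q N)"
      unfolding norm_ge_def by (intro always_eventually allI mc)
  qed
qed

end

theorem proposition1p6:
  fixes n :: nat
    and G :: "int \<Rightarrow> 'a::real_vector set"
    and pr :: "'a \<Rightarrow> 'a \<Rightarrow> real"
    and d :: "'a \<Rightarrow> 'a"
    and m :: "nat \<Rightarrow> 'a list \<Rightarrow> 'a"
    and E :: "'a set"
  assumes "\<exists>S::'a set. finite S \<and> span S = UNIV"
    and "cyclic_DGA n G pr d m"
    and "homogeneous_basis G E"
  shows "m2_plus n pr (m 2) \<in> Bcyc G 3 \<and>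
         maurer_cartan (bar_C n G) (Bcyc_filt G) (int n - 3) 2 (bar_ops n G pr d E)
           (\<lambda>l g. if (l, g) = (1, 0) then (\<lambda>i. tw [m2_plus n pr (m 2)]) else (\<lambda>i. 0))"
proof -
  interpret cyclic_dga_basis n G pr d m E
    using assms by unfold_locales
  show ?thesis using m2_plus_Bcyc maurer_cartan_m2_plus by blast
qed

end
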